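(* Let $w=w_1w_2\cdots w_n\in\{L,R\}^n$ be a rule-string with $w_1=L$ that has the even run-length property. Start the ant with rule-string $w$ at its home position, with its initial heading, in the universe in which every cell is in state $1$. Then the ant returns home infinitely often, and the following hold. (a) Each time the ant is at home, it travels from then until its next return home exactly once around the principal contour $C$ determined by the configuration at the moment it left home. A cell that is visited twice by $C$ does not change its orientation at the first of these two visits. (b) Each time the ant is at home, the universe is bilaterally symmetric: for every cell $Q$, the state of $Q$ equals the state of the mirror image of $Q$ under reflection in the line containing the home edge.
   Context: The plane is divided into unit squares (cells) whose corners are the points of $\mathbb{Z}^2$. A rule-string is a word $w=w_1\cdots w_n$ in the letters $L,R$. At each time every cell has a state in $\{1,\dots,n\}$. A cell in state $k$ is said to have orientation $w_k$, and it changes (switches) its orientation when its state changes from $k$ to $k'$ with $w_k\ne w_{k'}$. Ant dynamics: the ant sits at the midpoint of an edge between two cells, with a heading (north, south, east or west) perpendicular to that edge. In one step it enters the cell ahead of it. If that cell is in state $k$, the ant makes a $90^\circ$ turn, to the left if $w_k=L$ and to the right if $w_k=R$, and moves to the midpoint of the edge through which it then leaves the cell. As it leaves, the state of the cell changes from $k$ to $k+1$ (mod $n$, with states $1,\dots,n$). Home: the ant's starting edge (the home edge) and initial heading are fixed. The home position is the midpoint of the home edge. The ant is "at home" when it is at this midpoint. H-cells and V-cells: since the ant turns by a right angle at every step, its moves are alternately horizontal and vertical. So the cells split checkerboard-fashion into H-cells (always entered horizontally and exited vertically) and V-cells (always entered vertically and exited horizontally). The first cell entered is an H-cell if the initial heading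 is horizontal and a V-cell if it is vertical. In particular, the ant always crosses a given edge in the same direction. Truchet tiles and contours: each cell contains two quarter-circle arcs, of radius $1/2$ and centered at two opposite corners, each joining the midpoints of two adjacent sides. They represent the two routes through the cell for its current orientation. For an H-cell with orientation $L$ the arcs join right–bottom and left–top. For an H-cell with orientation $R$ they join right–top and left–bottom. For a V-cell with orientation $L$ they join bottom–left and top–right. For a V-cell with orientation $R$ they join bottom–right and top–left. If all but finitely many cells are in state $1$ (always the case when the universe starts with all cells in state $1$), the union of all these arcs is a disjoint union of simple closed curves, called Truchet contours. The principal contour of a configuration is the Truchet contour through the home position. A contour visits a cell twice if it contains both arcs of that cell. Even run-length property: $w$ has the even run-length property if, when its letters are arranged in cyclic order, it consists of alternate runs of $L$'s and $R$'s, each of even length (for example $LLRR$, $LRRL$, $LRRLLRRRRL$). *)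

theory Defs
  imports "HOL-Analysis.Analysis"
begin

section \<open>The grid\<close>

datatype letter = L | R

datatype direction = North | South | East | West

text \<open>A cell is named by its lower left corner: \<open>(x, y)\<close> stands for the unit square
  with corners \<open>(x, y)\<close> and \<open>(x + 1, y + 1)\<close>. Directions serve both as headings and as
  names for the sides of a cell.\<close>

type_synonym cell = "int \<times> int"

type_synonym point = "real \<times> real"

fun square :: "cell \<Rightarrow> point set" where
  "square (x, y) = {of_int x..of_int x + 1} \<times> {of_int y..of_int y + 1}"

fun neighbour :: "cell \<Rightarrow> direction \<Rightarrow> cell" where
  "neighbour (x, y) North = (x, y + 1)"
| "neighbour (x, y) South = (x, y - 1)"
| "neighbour (x, y) East = (x + 1, y)"
| "neighbour (x, y) West = (x - 1, y)"

fun side_midpoint :: "cell \<Rightarrow> direction \<Rightarrow> point" where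
  "side_midpoint (x, y) North = (of_int x + 1/2, of_int y + 1)"
| "side_midpoint (x, y) South = (of_int x + 1/2, of_int y)"
| "side_midpoint (x, y) East = (of_int x + 1, of_int y + 1/2)"
| "side_midpoint (x, y) West = (of_int x, of_int y + 1/2)"

fun opposite :: "direction \<Rightarrow> direction" where
  "opposite North = South"
| "opposite South = North"
| "opposite East = West"
| "opposite West = East"

definition horizontal :: "direction \<Rightarrow> bool" where
  "horizontal h \<longleftrightarrow> h = East \<or> h = West"

fun turn :: "letter \<Rightarrow> direction \<Rightarrow> direction" where
  "turn L North = West"
| "turn L West = South"
| "turn L South = East"
| "turn L East = North"
| "turn R North = East"
| "turn R East = South"
| "turn R South = West"
| "turn R West = North"


section \<open>Rule-strings\<close>

text \<open>The pairs \<open>(a, m)\<close> in \<open>runs\<close> are the runs \<open>a\<^sup>m\<close> of the cyclic word, listed from a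
  place where a run begins; cyclically consecutive runs use different letters. A constant
  word is a single run, and then the alternation condition is void.\<close>

definition even_run_length :: "letter list \<Rightarrow> bool" where
  "even_run_length w \<longleftrightarrow>
    (\<exists>k runs. rotate k w = concat (map (\<lambda>(a, m). replicate m a) runs) \<and>
       (\<forall>(a, m) \<in> set runs. 0 < m \<and> even m) \<and>
       (length runs \<ge> 2 \<longrightarrow>
          (\<forall>i < length runs. fst (runs ! i) \<noteq> fst (runs ! (Suc i mod length runs)))))"


section \<open>The ant\<close>

text \<open>States are \<open>1, \<dots>, n\<close> with \<open>n = length w\<close>, so state \<open>k\<close> selects the list entry with
  index \<open>k - 1\<close>.\<close>

type_synonym config = "cell \<Rightarrow> nat"

definition orientation :: "letter list \<Rightarrow> config \<Rightarrow> cell \<Rightarrow> letter" where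
  "orientation w c Q = w ! (c Q - 1)"

text \<open>In a global state \<open>(c, Q, h)\<close> the ant has heading \<open>h\<close> and is about to enter the
  cell \<open>Q\<close>, so it sits at the midpoint of the side of \<open>Q\<close> opposite to \<open>h\<close>.\<close>

type_synonym ant_state = "config \<times> cell \<times> direction"

fun ant_step :: "letter list \<Rightarrow> ant_state \<Rightarrow> ant_state" where
  "ant_step w (c, Q, h) =
    (let h' = turn (orientation w c Q) h
     in (c(Q := c Q mod length w + 1), neighbour Q h', h'))"

text \<open>\<open>Q\<^sub>0\<close> is the first cell entered and \<open>h\<^sub>0\<close> the initial heading; together they determine
  the home edge.\<close>

definition ant_run :: "letter list \<Rightarrow> cell \<Rightarrow> direction \<Rightarrow> nat \<Rightarrow> ant_state" where
  "ant_run w Q\<^sub>0 h\<^sub>0 t = (ant_step w ^^ t) (\<lambda>_. 1, Q\<^sub>0, h\<^sub>0)"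

definition config_at :: "letter list \<Rightarrow> cell \<Rightarrow> direction \<Rightarrow> nat \<Rightarrow> config" where
  "config_at w Q\<^sub>0 h\<^sub>0 t = fst (ant_run w Q\<^sub>0 h\<^sub>0 t)"

definition cell_at :: "letter list \<Rightarrow> cell \<Rightarrow> direction \<Rightarrow> nat \<Rightarrow> cell" where
  "cell_at w Q\<^sub>0 h\<^sub>0 t = fst (snd (ant_run w Q\<^sub>0 h\<^sub>0 t))"

definition heading_at :: "letter list \<Rightarrow> cell \<Rightarrow> direction \<Rightarrow> nat \<Rightarrow> direction" where
  "heading_at w Q\<^sub>0 h\<^sub>0 t = snd (snd (ant_run w Q\<^sub>0 h\<^sub>0 t))"

definition position_at :: "letter list \<Rightarrow> cell \<Rightarrow> direction \<Rightarrow> nat \<Rightarrow> point" where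
  "position_at w Q\<^sub>0 h\<^sub>0 t =
    side_midpoint (cell_at w Q\<^sub>0 h\<^sub>0 t) (opposite (heading_at w Q\<^sub>0 h\<^sub>0 t))"

definition home_position :: "cell \<Rightarrow> direction \<Rightarrow> point" where
  "home_position Q\<^sub>0 h\<^sub>0 = side_midpoint Q\<^sub>0 (opposite h\<^sub>0)"

definition at_home :: "letter list \<Rightarrow> cell \<Rightarrow> direction \<Rightarrow> nat \<Rightarrow> bool" where
  "at_home w Q\<^sub>0 h\<^sub>0 t \<longleftrightarrow> position_at w Q\<^sub>0 h\<^sub>0 t = home_position Q\<^sub>0 h\<^sub>0"

definition next_return :: "letter list \<Rightarrow> cell \<Rightarrow> direction \<Rightarrow> nat \<Rightarrow> nat \<Rightarrow> bool" where
  "next_return w Q\<^sub>0 h\<^sub>0 t t' \<longleftrightarrow>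
    t < t' \<and> at_home w Q\<^sub>0 h\<^sub>0 t' \<and> (\<forall>s. t < s \<and> s < t' \<longrightarrow> \<not> at_home w Q\<^sub>0 h\<^sub>0 s)"


section \<open>Truchet tiles and contours\<close>

definition H_cell :: "cell \<Rightarrow> direction \<Rightarrow> cell \<Rightarrow> bool" where
  "H_cell Q\<^sub>0 h\<^sub>0 Q \<longleftrightarrow>
    (even (fst Q + snd Q) = even (fst Q\<^sub>0 + snd Q\<^sub>0)) = horizontal h\<^sub>0"

text \<open>For adjacent sides \<open>a\<close> and \<open>b\<close>, \<open>corner Q a b\<close> is the vertex they share, and
  \<open>truchet_arc Q a b\<close> is the quarter circle around it joining their midpoints.\<close>

definition corner :: "cell \<Rightarrow> direction \<Rightarrow> direction \<Rightarrow> point" where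
  "corner Q a b =
    (of_int (fst Q) + (if East \<in> {a, b} then 1 else 0),
     of_int (snd Q) + (if North \<in> {a, b} then 1 else 0))"

definition truchet_arc :: "cell \<Rightarrow> direction \<Rightarrow> direction \<Rightarrow> point set" where
  "truchet_arc Q a b = square Q \<inter> sphere (corner Q a b) (1/2)"

definition tile_arcs ::
    "letter list \<Rightarrow> cell \<Rightarrow> direction \<Rightarrow> config \<Rightarrow> cell \<Rightarrow> point set set" where
  "tile_arcs w Q\<^sub>0 h\<^sub>0 c Q =
    (if H_cell Q\<^sub>0 h\<^sub>0 Q
     then (case orientation w c Q of
         L \<Rightarrow> {truchet_arc Q East South, truchet_arc Q West North}
       | R \<Rightarrow> {truchet_arc Q East North, truchet_arc Q West South})
     else (case orientation w c Q of
         L \<Rightarrow> {truchet_arc Q South West, truchet_arc Q North East}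
       | R \<Rightarrow> {truchet_arc Q South East, truchet_arc Q North West}))"

definition truchet_union ::
    "letter list \<Rightarrow> cell \<Rightarrow> direction \<Rightarrow> config \<Rightarrow> point set" where
  "truchet_union w Q\<^sub>0 h\<^sub>0 c = (\<Union>Q. \<Union> (tile_arcs w Q\<^sub>0 h\<^sub>0 c Q))"

text \<open>The arcs form a locally finite family, so the disjoint simple closed curves that make
  up their union are its connected components.\<close>

definition principal_contour ::
    "letter list \<Rightarrow> cell \<Rightarrow> direction \<Rightarrow> config \<Rightarrow> point set" where
  "principal_contour w Q\<^sub>0 h\<^sub>0 c =
    connected_component_set (truchet_union w Q\<^sub>0 h\<^sub>0 c) (home_position Q\<^sub>0 h\<^sub>0)"

definition visits_twice ::
    "letter list \<Rightarrow> cell \<Rightarrow> direction \<Rightarrow> config \<Rightarrow> point set \<Rightarrow> cell \<Rightarrow> bool" where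
  "visits_twice w Q\<^sub>0 h\<^sub>0 c C Q \<longleftrightarrow> (\<forall>A \<in> tile_arcs w Q\<^sub>0 h\<^sub>0 c Q. A \<subseteq> C)"

text \<open>The route the ant really takes in step \<open>t\<close>, from the side through which it enters to
  the side through which it leaves. It depends on the configuration at time \<open>t\<close>, not on the
  one at the last departure from home.\<close>

definition traversed_arc :: "letter list \<Rightarrow> cell \<Rightarrow> direction \<Rightarrow> nat \<Rightarrow> point set" where
  "traversed_arc w Q\<^sub>0 h\<^sub>0 t =
    truchet_arc (cell_at w Q\<^sub>0 h\<^sub>0 t)
      (opposite (heading_at w Q\<^sub>0 h\<^sub>0 t)) (heading_at w Q\<^sub>0 h\<^sub>0 (Suc t))"

text \<open>Consecutive traversed arcs share the position of the ant in between. So if the ant is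
  at the same place at times \<open>t\<close> and \<open>t'\<close>, the following says that it makes one full tour
  of the closed curve \<open>C\<close>: its arcs cover exactly \<open>C\<close>, and none is used twice.\<close>

definition travels_once_around ::
    "letter list \<Rightarrow> cell \<Rightarrow> direction \<Rightarrow> nat \<Rightarrow> nat \<Rightarrow> point set \<Rightarrow> bool" where
  "travels_once_around w Q\<^sub>0 h\<^sub>0 t t' C \<longleftrightarrow>
    inj_on (traversed_arc w Q\<^sub>0 h\<^sub>0) {t..<t'} \<and>
    (\<Union>s\<in>{t..<t'}. traversed_arc w Q\<^sub>0 h\<^sub>0 s) = C"


section \<open>Reflection in the home line\<close>

definition home_reflection :: "cell \<Rightarrow> direction \<Rightarrow> point \<Rightarrow> point" where
  "home_reflection Q\<^sub>0 h\<^sub>0 p =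
    (if horizontal h\<^sub>0 then (2 * fst (home_position Q\<^sub>0 h\<^sub>0) - fst p, snd p)
     else (fst p, 2 * snd (home_position Q\<^sub>0 h\<^sub>0) - snd p))"

text \<open>The reflection exchanges \<open>Q\<^sub>0\<close> with the cell on the other side of the home edge.\<close>

definition mirror_cell :: "cell \<Rightarrow> direction \<Rightarrow> cell \<Rightarrow> cell" where
  "mirror_cell Q\<^sub>0 h\<^sub>0 Q =
    (let B = neighbour Q\<^sub>0 (opposite h\<^sub>0)
     in if horizontal h\<^sub>0 then (fst Q\<^sub>0 + fst B - fst Q, snd Q)
        else (fst Q, snd Q\<^sub>0 + snd B - snd Q))"

lemma square_mirror_cell:
  "square (mirror_cell Q\<^sub>0 h\<^sub>0 Q) = home_reflection Q\<^sub>0 h\<^sub>0 ` square Q"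
proof -
  have inv: "home_reflection Q\<^sub>0 h\<^sub>0 (home_reflection Q\<^sub>0 h\<^sub>0 p) = p" for p
    by (simp add: home_reflection_def)
  have mem: "home_reflection Q\<^sub>0 h\<^sub>0 p \<in> square Q \<longleftrightarrow> p \<in> square (mirror_cell Q\<^sub>0 h\<^sub>0 Q)" for p
    by (cases Q\<^sub>0; cases Q; cases p; cases h\<^sub>0)
      (auto simp: home_reflection_def mirror_cell_def home_position_def horizontal_def Let_def)
  show ?thesis
    using inv mem by (metis (no_types, lifting) image_iff subsetI subset_antisym)
qed

end

theory Submission imports Defs begin

text \<open>Call a state \<open>k\<close> cold if its parity is such that passing from \<open>k\<close> to the next state
  stays inside a run of the cyclic word. Because all runs are even, one of the two parities
  is cold throughout, and every visit of the ant exchanges cold and hot; only hot cells can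
  switch.

  A port is an edge together with the heading in which it is crossed. In a fixed
  configuration the ant's rule is a permutation of the ports (\<open>follow\<close>), whose cycles are the
  Truchet contours. All but finitely many cells turn left, so all but finitely many ports lie
  on 4-cycles, and the cycle of the home port is finite.

  The invariant at the times when the ant is at home (\<open>tame\<close>) is that the contours can be
  coloured with two colours in such a way that a cell is cold exactly if the two contour arcs
  in it have the same colour (\<open>colouring\<close>). At the start, the contours are circles around the
  vertices of one of the two checkerboard classes, and either one colour suffices (all cells
  cold), or the vertices are coloured by the parity of their rows (all cells hot).

  Suppose that the invariant holds, and let \<open>C\<close> be the principal contour. A cell that \<open>C\<close>
  visits twice contains two arcs of the same contour, hence is cold, and does not switch at the
  first visit. Therefore the ant stays on \<open>C\<close> and comes home having gone around once
  (\<open>tour\<close>). To restore the invariant, exchange the two colours on \<open>C\<close>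
  (\<open>colouring_toured\<close>): a cell visited once changes its temperature and the colour of one of its
  arcs, a cell visited twice keeps its temperature and changes the colour of both. A cell that has
  switched is cold afterwards, so its four edges have one colour and it does not matter
  for the colouring how its new arcs join them.

  Bilateral symmetry persists because in a symmetric configuration the reflection maps \<open>C\<close> to
  itself with reversed direction, so that a cell and its mirror image receive equally many
  visits (\<open>visits_mirror\<close>).

  That the connected component of the arcs through the home position is indeed the cycle of the
  home port rests on \<open>routes_meet\<close>, arcs meet only if they are consecutive, and on
  local finiteness of the family of arcs (\<open>principal_contour_eq_orbit\<close>).\<close>

section \<open>Ports and the walk in a fixed configuration\<close>

text \<open>The port \<open>(Q, h)\<close> is the edge through which the cell \<open>Q\<close> is entered with heading \<open>h\<close>. The
  ant always crosses an edge in the same direction; the ports that respect this are the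
  admissible ones, and they correspond to the edges.\<close>

type_synonym port = "cell \<times> direction"

definition follow :: "letter list \<Rightarrow> config \<Rightarrow> port \<Rightarrow> port" where
  "follow w c p =
    (let h = turn (orientation w c (fst p)) (snd p) in (neighbour (fst p) h, h))"

definition admissible :: "cell \<Rightarrow> direction \<Rightarrow> port \<Rightarrow> bool" where
  "admissible Q\<^sub>0 h\<^sub>0 p \<longleftrightarrow> horizontal (snd p) = H_cell Q\<^sub>0 h\<^sub>0 (fst p)"

definition entry :: "port \<Rightarrow> point" where
  "entry p = side_midpoint (fst p) (opposite (snd p))"

definition route :: "letter list \<Rightarrow> config \<Rightarrow> port \<Rightarrow> point set" where
  "route w c p =
    truchet_arc (fst p) (opposite (snd p)) (turn (orientation w c (fst p)) (snd p))"

definition orbit :: "letter list \<Rightarrow> config \<Rightarrow> port \<Rightarrow> port set" where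
  "orbit w c p = range (\<lambda>j. (follow w c ^^ j) p)"

lemma finite_headings [simp]: "finite (A :: direction set)"
  by (rule finite_subset[of _ "{North, South, East, West}"]) (auto intro: direction.exhaust)

lemma opposite_opposite [simp]: "opposite (opposite h) = h"
  by (cases h) auto

lemma horizontal_opposite [simp]: "horizontal (opposite h) = horizontal h"
  by (cases h) (auto simp: horizontal_def)

lemma opposite_neq [simp]: "opposite h \<noteq> h" "h \<noteq> opposite h"
  by (cases h; simp)+

lemma same_axis: "horizontal h = horizontal h' \<longleftrightarrow> h' = h \<or> h' = opposite h"
  by (cases h; cases h') (auto simp: horizontal_def)

lemma horizontal_turn [simp]: "horizontal (turn l h) \<longleftrightarrow> \<not> horizontal h"
  by (cases l; cases h) (auto simp: horizontal_def)

lemma turn_other_letter: "l \<noteq> l' \<Longrightarrow> turn l' h = turn l (opposite h)"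
  by (cases l; cases l'; cases h) auto

lemma turn_inject: "turn l h = turn l h' \<longleftrightarrow> h = h'"
  by (cases l; cases h; cases h') auto

lemma neighbour_opposite [simp]: "neighbour (neighbour Q h) (opposite h) = Q"
  by (cases Q; cases h) auto

lemma neighbour_opposite' [simp]: "neighbour (neighbour Q (opposite h)) h = Q"
  by (cases Q; cases h) auto

lemma H_cell_neighbour [simp]: "H_cell Q\<^sub>0 h\<^sub>0 (neighbour Q h) \<longleftrightarrow> \<not> H_cell Q\<^sub>0 h\<^sub>0 Q"
  by (cases Q; cases h) (auto simp: H_cell_def)

lemma snd_follow: "snd (follow w c p) = turn (orientation w c (fst p)) (snd p)"
  by (simp add: follow_def Let_def)

lemma leave_follow:
  "neighbour (fst (follow w c p)) (opposite (snd (follow w c p))) = fst p"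
  by (simp add: follow_def Let_def)

lemma inj_follow: "inj (follow w c)"
proof
  fix p q assume eq: "follow w c p = follow w c q"
  have "fst p = fst q"
    using leave_follow[of w c p] leave_follow[of w c q] eq by simp
  moreover have "snd p = snd q"
    using snd_follow[of w c p] snd_follow[of w c q] eq \<open>fst p = fst q\<close>
    by (simp add: turn_inject)
  ultimately show "p = q"
    by (rule prod_eqI)
qed

lemma admissible_follow:
  "admissible Q\<^sub>0 h\<^sub>0 p \<Longrightarrow> admissible Q\<^sub>0 h\<^sub>0 (follow w c p)"
  by (simp add: admissible_def follow_def Let_def)

lemma admissible_home: "admissible Q\<^sub>0 h\<^sub>0 (Q\<^sub>0, h\<^sub>0)"
  by (simp add: admissible_def H_cell_def)

lemma admissible_same_cell:
  assumes "admissible Q\<^sub>0 h\<^sub>0 (Q, h)"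
  shows "admissible Q\<^sub>0 h\<^sub>0 (Q, h') \<longleftrightarrow> h' = h \<or> h' = opposite h"
  using assms same_axis[of h h'] by (auto simp: admissible_def)

text \<open>Every edge carries two headings, but admissibility leaves only one of them.\<close>

lemma entry_inject:
  assumes "admissible Q\<^sub>0 h\<^sub>0 p" "admissible Q\<^sub>0 h\<^sub>0 q" "entry p = entry q"
  shows "p = q"
proof -
  obtain x y h x' y' h' where [simp]: "p = ((x, y), h)" "q = ((x', y'), h')"
    by (metis prod.exhaust_sel)
  have half1: "of_int a + 1/2 \<noteq> (of_int b :: real)" for a b :: int
  proof
    assume "of_int a + 1/2 = (of_int b :: real)"
    then have "real_of_int (2 * a + 1) = real_of_int (2 * b)"
      by simp
    then show False
      unfolding of_int_eq_iff by presburger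
  qed
  have half: "of_int a + 1/2 \<noteq> (of_int b :: real)" "of_int b \<noteq> (of_int a + 1/2 :: real)"
    "of_int a + 1/2 \<noteq> (of_int b + 1 :: real)" "of_int b + 1 \<noteq> (of_int a + 1/2 :: real)"
    for a b :: int
    using half1[of a b] half1[of a "b + 1"] by auto
  have shift: "of_int a + 1 = (of_int b :: real) \<longleftrightarrow> a + 1 = b"
    "of_int b = (of_int a + 1 :: real) \<longleftrightarrow> b = a + 1" for a b :: int
    by linarith+
  show ?thesis
    using assms
    by (cases h; cases h')
      (auto simp: entry_def admissible_def horizontal_def H_cell_def half shift)
qed

lemma orbit_self: "p \<in> orbit w c p"
  unfolding orbit_def by (rule range_eqI[of _ _ 0]) simp

lemma admissible_orbit:
  assumes "admissible Q\<^sub>0 h\<^sub>0 p" "q \<in> orbit w c p"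
  shows "admissible Q\<^sub>0 h\<^sub>0 q"
proof -
  have "admissible Q\<^sub>0 h\<^sub>0 ((follow w c ^^ j) p)" for j
    by (induction j) (auto simp: assms admissible_follow)
  then show ?thesis
    using assms(2) by (auto simp: orbit_def)
qed

lemma orbit_period:
  assumes fin: "finite (orbit w c p)"
  obtains T where "0 < T" "(follow w c ^^ T) p = p"
    "inj_on (\<lambda>j. (follow w c ^^ j) p) {..<T}"
    "orbit w c p = (\<lambda>j. (follow w c ^^ j) p) ` {..<T}"
proof -
  let ?f = "follow w c"
  have "finite {y. \<exists>n. y = (?f ^^ n) p}"
    using fin by (simp add: orbit_def full_SetCompr_eq)
  then obtain n where n: "n > 0" "(?f ^^ n) p = p"
    using funpow_inj_finite[OF inj_follow] by blast
  define T where "T = (LEAST n. 0 < n \<and> (?f ^^ n) p = p)"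
  have T: "0 < T" "(?f ^^ T) p = p"
    using LeastI[of "\<lambda>n. 0 < n \<and> (?f ^^ n) p = p"] n unfolding T_def by blast+
  have min: "T \<le> m" if "0 < m" "(?f ^^ m) p = p" for m
    unfolding T_def using that by (intro Least_le) blast
  have no_repeat: False if "i < j" "j < T" "(?f ^^ i) p = (?f ^^ j) p" for i j
  proof -
    have "(?f ^^ i) p = (?f ^^ i) ((?f ^^ (j - i)) p)"
      using that by (simp flip: funpow_add[THEN fun_cong, unfolded comp_apply])
    then have "(?f ^^ (j - i)) p = p"
      using inj_fn[OF inj_follow] by (metis injD)
    then show False
      using min[of "j - i"] that by simp
  qed
  have inj: "inj_on (\<lambda>j. (?f ^^ j) p) {..<T}"
    by (rule inj_onI) (metis lessThan_iff linorder_neqE_nat no_repeat)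
  have "(?f ^^ j) p = (?f ^^ (j mod T)) p" for j
    using T by (simp add: funpow_mod_eq)
  then have "orbit w c p = (\<lambda>j. (?f ^^ j) p) ` {..<T}"
    using T(1) by (force simp: orbit_def)
  with T inj that show ?thesis by blast
qed

lemma follow_mem_orbit_iff:
  assumes "finite (orbit w c p)"
  shows "follow w c q \<in> orbit w c p \<longleftrightarrow> q \<in> orbit w c p"
proof
  assume "q \<in> orbit w c p"
  then obtain j where "q = (follow w c ^^ j) p"
    by (auto simp: orbit_def)
  then show "follow w c q \<in> orbit w c p"
    unfolding orbit_def by (intro range_eqI[of _ _ "Suc j"]) simp
next
  assume *: "follow w c q \<in> orbit w c p"
  obtain T where T: "0 < T" "(follow w c ^^ T) p = p"
    "orbit w c p = (\<lambda>j. (follow w c ^^ j) p) ` {..<T}"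
    using orbit_period[OF assms] by metis
  obtain j where j: "follow w c q = (follow w c ^^ j) p"
    using * by (auto simp: orbit_def)
  have "\<exists>i. follow w c q = (follow w c ^^ Suc i) p"
  proof (cases j)
    case 0
    then show ?thesis
      using T j by (intro exI[of _ "T - 1"]) simp
  qed (use j in blast)
  then obtain i where "q = (follow w c ^^ i) p"
    using inj_follow[of w c] by (auto dest: injD)
  then show "q \<in> orbit w c p"
    by (simp add: orbit_def)
qed

text \<open>Where all cells are in state 1, hence turn left, a walk runs around a single grid
  vertex in four steps. An infinite orbit would have to leave the finite set of ports from
  which these four steps meet another state; but an orbit containing a 4-cycle is that
  4-cycle, by injectivity.\<close>

lemma finite_orbit:
  assumes L: "w ! 0 = L" and fin: "finite {Q. c Q \<noteq> 1}"
  shows "finite (orbit w c p)"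
proof -
  let ?f = "follow w c" and ?g = "follow w (\<lambda>_. 1)"
  have g4: "(?g ^^ 4) q = q" for q
    by (cases q; cases "fst q"; cases "snd q")
      (auto simp: follow_def orientation_def L numeral_eq_Suc)
  define B where "B = (\<Union>j<4. (?g ^^ j) -` ({Q. c Q \<noteq> 1} \<times> UNIV))"
  have "finite B"
    unfolding B_def
    by (intro finite_UN_I finite_vimageI finite_cartesian_product fin inj_fn inj_follow) simp_all
  show ?thesis
  proof (cases "orbit w c p \<subseteq> B")
    case True
    then show ?thesis
      using \<open>finite B\<close> finite_subset by blast
  next
    case False
    then obtain k where k: "(?f ^^ k) p \<notin> B"
      unfolding orbit_def by (metis image_subsetI)
    define q where "q = (?f ^^ k) p"
    have fg: "?f r = ?g r" if "c (fst r) = 1" for r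
      using that by (simp add: follow_def orientation_def)
    have "(?f ^^ j) q = (?g ^^ j) q" if "j \<le> 4" for j
      using that
    proof (induction j)
      case (Suc j)
      then have "j \<in> {..<4}"
        by simp
      then have "(?g ^^ j) q \<notin> {Q. c Q \<noteq> 1} \<times> UNIV"
        using k unfolding B_def q_def by blast
      then have "c (fst ((?g ^^ j) q)) = 1"
        by (simp add: mem_Times_iff)
      with Suc show ?case
        by (simp add: fg)
    qed simp
    then have "(?f ^^ 4) q = q"
      using g4 by simp
    then have "(?f ^^ k) ((?f ^^ 4) p) = (?f ^^ k) p"
      unfolding q_def by (metis funpow_add comp_apply add.commute)
    then have "(?f ^^ 4) p = p"
      using inj_fn[OF inj_follow] by (metis injD)
    then have "(?f ^^ j) p = (?f ^^ (j mod 4)) p" for j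
      by (simp add: funpow_mod_eq)
    then have "orbit w c p \<subseteq> (\<lambda>j. (?f ^^ j) p) ` {..<4}"
      by (force simp: orbit_def)
    then show ?thesis
      by (rule finite_subset) simp
  qed
qed


section \<open>Reflection\<close>

text \<open>The mirror edge is crossed in its own direction, which is opposite to the reflected one: the
  reflected port leaves the mirror image of the cell that the original enters.\<close>

definition mirror_port :: "cell \<Rightarrow> direction \<Rightarrow> port \<Rightarrow> port" where
  "mirror_port Q\<^sub>0 h\<^sub>0 p =
    (mirror_cell Q\<^sub>0 h\<^sub>0 (neighbour (fst p) (opposite (snd p))),
     if horizontal (snd p) = horizontal h\<^sub>0 then snd p else opposite (snd p))"

lemma mirror_cell_mirror_cell [simp]:
  "mirror_cell Q\<^sub>0 h\<^sub>0 (mirror_cell Q\<^sub>0 h\<^sub>0 Q) = Q"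
  by (cases Q\<^sub>0; cases Q; cases h\<^sub>0) (auto simp: mirror_cell_def horizontal_def Let_def)

lemma mirror_port_home: "mirror_port Q\<^sub>0 h\<^sub>0 (Q\<^sub>0, h\<^sub>0) = (Q\<^sub>0, h\<^sub>0)"
  by (cases Q\<^sub>0; cases h\<^sub>0)
    (auto simp: mirror_cell_def mirror_port_def horizontal_def Let_def)

lemma inj_mirror_port: "inj (mirror_port Q\<^sub>0 h\<^sub>0)"
proof
  fix p q assume eq: "mirror_port Q\<^sub>0 h\<^sub>0 p = mirror_port Q\<^sub>0 h\<^sub>0 q"
  then have h: "snd p = snd q"
    by (cases "snd p"; cases "snd q"; cases h\<^sub>0) (auto simp: mirror_port_def horizontal_def)
  have "neighbour (fst p) (opposite (snd p)) = neighbour (fst q) (opposite (snd q))"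
    using eq mirror_cell_mirror_cell unfolding mirror_port_def by (metis fst_conv)
  then have "fst p = fst q"
    unfolding h by (metis neighbour_opposite')
  with h show "p = q"
    by (simp add: prod_eqI)
qed

lemma mirror_port_follow:
  "fst (mirror_port Q\<^sub>0 h\<^sub>0 (follow w c p)) = mirror_cell Q\<^sub>0 h\<^sub>0 (fst p)"
  by (simp add: mirror_port_def leave_follow)

lemma follow_mirror_port:
  assumes "\<And>Q. c (mirror_cell Q\<^sub>0 h\<^sub>0 Q) = c Q"
  shows "follow w c (mirror_port Q\<^sub>0 h\<^sub>0 (follow w c p)) = mirror_port Q\<^sub>0 h\<^sub>0 p"
proof -
  obtain Q h where p: "p = (Q, h)" by (cases p)
  define l where "l = orientation w c Q"
  have l: "orientation w c (mirror_cell Q\<^sub>0 h\<^sub>0 Q) = l"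
    by (simp add: l_def orientation_def assms)
  define k where
    "k = (if horizontal (turn l h) = horizontal h\<^sub>0 then turn l h else opposite (turn l h))"
  have "mirror_port Q\<^sub>0 h\<^sub>0 (follow w c p) = (mirror_cell Q\<^sub>0 h\<^sub>0 Q, k)"
    by (simp add: mirror_port_def follow_def Let_def p l_def k_def)
  moreover have "(neighbour (mirror_cell Q\<^sub>0 h\<^sub>0 Q) (turn l k), turn l k) = mirror_port Q\<^sub>0 h\<^sub>0 (Q, h)"
    unfolding k_def
    by (cases Q; cases Q\<^sub>0; cases h; cases h\<^sub>0; cases l)
      (auto simp: mirror_cell_def mirror_port_def horizontal_def Let_def)
  ultimately show ?thesis
    by (simp add: follow_def l p)
qed

text \<open>Reflection conjugates the walk with its inverse and fixes the home port, so it preserves the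
  cycle of that port.\<close>

lemma mirror_port_orbit:
  assumes sym: "\<And>Q. c (mirror_cell Q\<^sub>0 h\<^sub>0 Q) = c Q"
    and fin: "finite (orbit w c (Q\<^sub>0, h\<^sub>0))" and q: "q \<in> orbit w c (Q\<^sub>0, h\<^sub>0)"
  shows "mirror_port Q\<^sub>0 h\<^sub>0 q \<in> orbit w c (Q\<^sub>0, h\<^sub>0)"
proof -
  have "mirror_port Q\<^sub>0 h\<^sub>0 ((follow w c ^^ j) (Q\<^sub>0, h\<^sub>0)) \<in> orbit w c (Q\<^sub>0, h\<^sub>0)" for j
  proof (induction j)
    case 0
    show ?case by (simp add: mirror_port_home orbit_self)
  next
    case (Suc j)
    moreover have "follow w c (mirror_port Q\<^sub>0 h\<^sub>0 (follow w c ((follow w c ^^ j) (Q\<^sub>0, h\<^sub>0)))) =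
        mirror_port Q\<^sub>0 h\<^sub>0 ((follow w c ^^ j) (Q\<^sub>0, h\<^sub>0))"
      by (rule follow_mirror_port) (rule sym)
    ultimately show ?case
      using follow_mem_orbit_iff[OF fin] by (metis comp_apply funpow.simps(2))
  qed
  then show ?thesis
    using q by (auto simp: orbit_def)
qed

definition visits :: "letter list \<Rightarrow> config \<Rightarrow> port \<Rightarrow> cell \<Rightarrow> nat" where
  "visits w c p Q = card {h. (Q, h) \<in> orbit w c p}"

text \<open>Reflection reverses the principal contour, so it turns the edges by which the contour
  leaves a cell into those by which it enters the mirror image.\<close>

lemma visits_mirror:
  assumes sym: "\<And>Q. c (mirror_cell Q\<^sub>0 h\<^sub>0 Q) = c Q"
    and fin: "finite (orbit w c (Q\<^sub>0, h\<^sub>0))"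
  shows "visits w c (Q\<^sub>0, h\<^sub>0) (mirror_cell Q\<^sub>0 h\<^sub>0 Q) = visits w c (Q\<^sub>0, h\<^sub>0) Q"
proof -
  let ?O = "orbit w c (Q\<^sub>0, h\<^sub>0)" and ?M = "mirror_cell Q\<^sub>0 h\<^sub>0"
  have le: "visits w c (Q\<^sub>0, h\<^sub>0) Q \<le> visits w c (Q\<^sub>0, h\<^sub>0) (?M Q)" for Q
    unfolding visits_def
  proof (rule card_inj_on_le)
    let ?r = "\<lambda>h. mirror_port Q\<^sub>0 h\<^sub>0 (follow w c (Q, h))"
    have r: "?r h = (?M Q, snd (?r h))" for h
      by (simp add: prod_eq_iff mirror_port_follow)
    show "inj_on (\<lambda>h. snd (?r h)) {h. (Q, h) \<in> ?O}"
    proof (rule inj_onI)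
      fix h h' assume "snd (?r h) = snd (?r h')"
      then have "?r h = ?r h'"
        using r by metis
      then show "h = h'"
        using inj_mirror_port inj_follow by (metis injD snd_conv)
    qed
    show "(\<lambda>h. snd (?r h)) ` {h. (Q, h) \<in> ?O} \<subseteq> {h. (?M Q, h) \<in> ?O}"
      using r mirror_port_orbit[OF sym fin] follow_mem_orbit_iff[OF fin] by (auto, metis)
  qed simp
  show ?thesis
    using le[of Q] le[of "?M Q"] by simp
qed


section \<open>The invariant\<close>

definition advance :: "letter list \<Rightarrow> nat \<Rightarrow> nat" where
  "advance w k = k mod length w + 1"

text \<open>The configuration after each cell has been visited as often as the orbit passes through it.\<close>

definition toured :: "letter list \<Rightarrow> config \<Rightarrow> port \<Rightarrow> config" where
  "toured w c p Q = (advance w ^^ visits w c p Q) (c Q)"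

locale even_run_ant =
  fixes w :: "letter list" and Q\<^sub>0 :: cell and h\<^sub>0 :: direction and cold :: "nat \<Rightarrow> bool"
  assumes nonempty: "w \<noteq> []" and first_L: "w ! 0 = L"
    and cold_advance: "\<And>k. k \<in> {1..length w} \<Longrightarrow> cold (advance w k) \<longleftrightarrow> \<not> cold k"
    and cold_keeps: "\<And>k. k \<in> {1..length w} \<Longrightarrow> cold k \<Longrightarrow> w ! (advance w k - 1) = w ! (k - 1)"
begin

definition colouring :: "config \<Rightarrow> (port \<Rightarrow> bool) \<Rightarrow> bool" where
  "colouring c \<phi> \<longleftrightarrow>
    (\<forall>p. admissible Q\<^sub>0 h\<^sub>0 p \<longrightarrow>
      \<phi> (follow w c p) = \<phi> p \<and>
      (cold (c (fst p)) \<longleftrightarrow> \<phi> (fst p, opposite (snd p)) = \<phi> p))"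

definition tame :: "config \<Rightarrow> bool" where
  "tame c \<longleftrightarrow>
    (\<forall>Q. c Q \<in> {1..length w}) \<and> finite {Q. c Q \<noteq> 1} \<and>
    (\<forall>Q. c (mirror_cell Q\<^sub>0 h\<^sub>0 Q) = c Q) \<and> (\<exists>\<phi>. colouring c \<phi>)"

lemma colouring_follow:
  "colouring c \<phi> \<Longrightarrow> admissible Q\<^sub>0 h\<^sub>0 p \<Longrightarrow> \<phi> (follow w c p) = \<phi> p"
  unfolding colouring_def by blast

lemma colouring_cold:
  assumes "colouring c \<phi>" "admissible Q\<^sub>0 h\<^sub>0 (Q, h)"
  shows "cold (c Q) \<longleftrightarrow> \<phi> (Q, opposite h) = \<phi> (Q, h)"
  using assms unfolding colouring_def by (metis fst_conv snd_conv)

lemma tame_state: "tame c \<Longrightarrow> c Q \<in> {1..length w}"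
  unfolding tame_def by blast

lemma tame_mirror: "tame c \<Longrightarrow> c (mirror_cell Q\<^sub>0 h\<^sub>0 Q) = c Q"
  unfolding tame_def by blast

lemma tame_finite_orbit: "tame c \<Longrightarrow> finite (orbit w c p)"
  by (simp add: tame_def finite_orbit first_L)

lemma advance_range: "k \<in> {1..length w} \<Longrightarrow> (advance w ^^ v) k \<in> {1..length w}"
proof (induction v)
  case (Suc v)
  have "(advance w ^^ v) k mod length w < length w"
    using nonempty by simp
  then show ?case
    by (simp add: advance_def[of w "(advance w ^^ v) k"] Suc_le_eq)
qed simp

lemma exists_admissible: "\<exists>h. admissible Q\<^sub>0 h\<^sub>0 (Q, h)"
  unfolding admissible_def by (metis fst_conv horizontal_def direction.distinct(3,5) snd_conv)

text \<open>If state 1 is hot, neighbouring circles must have different colours. The four ports of a circle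
  turn left around a vertex; its second coordinate, which is the number whose parity is taken
  below, distinguishes the two vertices that the arcs of a cell surround.\<close>

lemma tame_initial: "tame (\<lambda>_. 1)"
proof -
  have "length w \<ge> 1"
    using nonempty by (cases w) auto
  moreover have "\<exists>\<phi>. colouring (\<lambda>_. 1) \<phi>"
  proof (cases "cold 1")
    case True
    then have "colouring (\<lambda>_. 1) (\<lambda>_. True)"
      by (simp add: colouring_def)
    then show ?thesis by blast
  next
    case False
    define \<phi> where "\<phi> = (\<lambda>p :: port. even (snd (fst p) + (if snd p \<in> {East, South} then 1 else 0)))"
    have "\<phi> (follow w (\<lambda>_. 1) p) = \<phi> p \<and> \<phi> (fst p, opposite (snd p)) \<noteq> \<phi> p" for p
      by (cases p; cases "fst p"; cases "snd p")
        (auto simp: \<phi>_def follow_def orientation_def first_L)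
    then have "colouring (\<lambda>_. 1) \<phi>"
      using False by (simp add: colouring_def)
    then show ?thesis by blast
  qed
  ultimately show ?thesis
    by (simp add: tame_def)
qed

lemma visits_admissible:
  assumes "admissible Q\<^sub>0 h\<^sub>0 (Q, h)"
  shows "visits w c (Q\<^sub>0, h\<^sub>0) Q =
    of_bool ((Q, h) \<in> orbit w c (Q\<^sub>0, h\<^sub>0)) + of_bool ((Q, opposite h) \<in> orbit w c (Q\<^sub>0, h\<^sub>0))"
proof -
  let ?orb = "orbit w c (Q\<^sub>0, h\<^sub>0)"
  have "k = h \<or> k = opposite h" if "(Q, k) \<in> ?orb" for k
    using admissible_orbit[OF admissible_home that] admissible_same_cell[OF assms] by blast
  then have "{k. (Q, k) \<in> ?orb} =
      (if (Q, h) \<in> ?orb then {h} else {}) \<union> (if (Q, opposite h) \<in> ?orb then {opposite h} else {})"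
    by auto
  then show ?thesis
    by (simp add: visits_def)
qed

lemma visits_le_2: "visits w c (Q\<^sub>0, h\<^sub>0) Q \<le> 2"
proof -
  obtain h where "admissible Q\<^sub>0 h\<^sub>0 (Q, h)"
    using exists_admissible by blast
  then show ?thesis
    by (simp add: visits_admissible)
qed

lemma colouring_orbit:
  assumes "colouring c \<phi>" "q \<in> orbit w c (Q\<^sub>0, h\<^sub>0)"
  shows "\<phi> q = \<phi> (Q\<^sub>0, h\<^sub>0)"
proof -
  have "(follow w c ^^ j) (Q\<^sub>0, h\<^sub>0) \<in> orbit w c (Q\<^sub>0, h\<^sub>0)" for j
    by (simp add: orbit_def)
  then have "admissible Q\<^sub>0 h\<^sub>0 ((follow w c ^^ j) (Q\<^sub>0, h\<^sub>0))" for j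
    using admissible_orbit[OF admissible_home] by blast
  then have "\<phi> ((follow w c ^^ j) (Q\<^sub>0, h\<^sub>0)) = \<phi> (Q\<^sub>0, h\<^sub>0)" for j
    by (induction j) (simp_all add: colouring_follow[OF assms(1)])
  then show ?thesis
    using assms(2) by (auto simp: orbit_def)
qed

lemma cold_if_visited_twice:
  assumes "tame c" "visits w c (Q\<^sub>0, h\<^sub>0) Q = 2"
  shows "cold (c Q)"
proof -
  obtain \<phi> where \<phi>: "colouring c \<phi>"
    using assms(1) by (auto simp: tame_def)
  obtain h where h: "admissible Q\<^sub>0 h\<^sub>0 (Q, h)"
    using exists_admissible by blast
  then have "(Q, h) \<in> orbit w c (Q\<^sub>0, h\<^sub>0)" "(Q, opposite h) \<in> orbit w c (Q\<^sub>0, h\<^sub>0)"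
    using assms(2) by (auto simp: visits_admissible of_bool_def split: if_splits)
  then show ?thesis
    using colouring_orbit[OF \<phi>] colouring_cold[OF \<phi> h] by simp
qed

lemma cold_advances:
  "k \<in> {1..length w} \<Longrightarrow> cold ((advance w ^^ v) k) \<longleftrightarrow> (cold k \<longleftrightarrow> even v)"
proof (induction v)
  case (Suc v)
  then show ?case
    using cold_advance[OF advance_range[of k v]] by auto
qed simp

text \<open>As long as the orbit has not passed through a cell for the last time, the cell shows its initial
  orientation: it has not been visited yet, or once and was cold.\<close>

lemma orientation_unvisited:
  assumes "tame c" "v < visits w c (Q\<^sub>0, h\<^sub>0) Q"
  shows "w ! ((advance w ^^ v) (c Q) - 1) = w ! (c Q - 1)"
proof (cases v)
  case (Suc v')
  then have "v = 1" "visits w c (Q\<^sub>0, h\<^sub>0) Q = 2"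
    using assms(2) visits_le_2[of c Q] by auto
  then show ?thesis
    using cold_keeps[OF tame_state[OF assms(1)]] cold_if_visited_twice[OF assms(1)] by simp
qed simp

text \<open>A visit changes the temperature of the cell and the colour of the arc used. If the
  orientation of a cell changes, the new route of a port is the old route of the opposite port;
  then the cell has become cold, so both ports have the same new colour.\<close>

lemma colouring_toured:
  assumes c: "tame c" and \<phi>: "colouring c \<phi>"
  defines "orb \<equiv> orbit w c (Q\<^sub>0, h\<^sub>0)"
  shows "colouring (toured w c (Q\<^sub>0, h\<^sub>0)) (\<lambda>p. \<phi> p \<noteq> (p \<in> orb))"
  unfolding colouring_def
proof (intro allI impI conjI)
  fix p assume p: "admissible Q\<^sub>0 h\<^sub>0 p"
  obtain Q h where [simp]: "p = (Q, h)" by (cases p)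
  let ?c = "toured w c (Q\<^sub>0, h\<^sub>0)" and ?\<psi> = "\<lambda>p. \<phi> p \<noteq> (p \<in> orb)" and ?p = "(Q, opposite h)"
  have cQ: "c Q \<in> {1..length w}"
    using c by (rule tame_state)
  have cold: "cold (c Q) \<longleftrightarrow> \<phi> ?p = \<phi> p"
    using colouring_cold[OF \<phi>, of Q h] p by simp
  have visits: "visits w c (Q\<^sub>0, h\<^sub>0) Q = of_bool (p \<in> orb) + of_bool (?p \<in> orb)"
    using p visits_admissible[of Q h] by (simp add: orb_def)
  have same: "?\<psi> (follow w c q) = ?\<psi> q" if "admissible Q\<^sub>0 h\<^sub>0 q" for q
    using colouring_follow[OF \<phi> that] follow_mem_orbit_iff[OF tame_finite_orbit[OF c]]
    by (simp add: orb_def)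
  show cold': "cold (?c (fst p)) \<longleftrightarrow> ?\<psi> (fst p, opposite (snd p)) = ?\<psi> p"
    using cold_advances[OF cQ, of "visits w c (Q\<^sub>0, h\<^sub>0) Q"] cold
    by (auto simp: toured_def visits)
  show "?\<psi> (follow w ?c p) = ?\<psi> p"
  proof (cases "orientation w ?c Q = orientation w c Q")
    case True
    then have "follow w ?c p = follow w c p"
      by (simp add: follow_def)
    then show ?thesis
      using same[OF p] by simp
  next
    case False
    then have swap: "follow w ?c p = follow w c ?p"
      using turn_other_letter[of "orientation w c Q" "orientation w ?c Q"]
      by (simp add: follow_def Let_def)
    (* One visit of a cold cell is the only way to leave it hot, and it does not switch then. *)
    have "cold (?c Q)"
    proof (rule ccontr)
      assume "\<not> cold (?c Q)"
      moreover have "visits w c (Q\<^sub>0, h\<^sub>0) Q \<noteq> 0"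
        using False by (auto simp: orientation_def toured_def intro: ccontr)
      ultimately have "visits w c (Q\<^sub>0, h\<^sub>0) Q = 1 \<and> cold (c Q)"
        using cold_advances[OF cQ, of "visits w c (Q\<^sub>0, h\<^sub>0) Q"] visits_le_2[of c Q]
          cold_if_visited_twice[OF c, of Q]
        by (auto simp: toured_def le_Suc_eq numeral_2_eq_2)
      then show False
        using False cold_keeps[OF cQ] by (simp add: orientation_def toured_def)
    qed
    then have "?\<psi> ?p = ?\<psi> p"
      using cold' by simp
    moreover have "admissible Q\<^sub>0 h\<^sub>0 ?p"
      using p by (simp add: admissible_def)
    ultimately show ?thesis
      using same[of ?p] swap by simp
  qed
qed

lemma tame_toured:
  assumes "tame c"
  shows "tame (toured w c (Q\<^sub>0, h\<^sub>0))"
proof -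
  note fin = tame_finite_orbit[OF assms, of "(Q\<^sub>0, h\<^sub>0)"]
  have "{Q. toured w c (Q\<^sub>0, h\<^sub>0) Q \<noteq> 1} \<subseteq> {Q. c Q \<noteq> 1} \<union> fst ` orbit w c (Q\<^sub>0, h\<^sub>0)"
  proof
    fix Q assume Q: "Q \<in> {Q. toured w c (Q\<^sub>0, h\<^sub>0) Q \<noteq> 1}"
    show "Q \<in> {Q. c Q \<noteq> 1} \<union> fst ` orbit w c (Q\<^sub>0, h\<^sub>0)"
    proof (cases "visits w c (Q\<^sub>0, h\<^sub>0) Q = 0")
      case False
      then obtain h where "(Q, h) \<in> orbit w c (Q\<^sub>0, h\<^sub>0)"
        by (force simp: visits_def)
      then show ?thesis
        by (force intro: rev_image_eqI)
    qed (use Q in \<open>auto simp: toured_def\<close>)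
  qed
  then have "finite {Q. toured w c (Q\<^sub>0, h\<^sub>0) Q \<noteq> 1}"
    by (rule finite_subset) (use assms fin in \<open>simp add: tame_def\<close>)
  moreover have "visits w c (Q\<^sub>0, h\<^sub>0) (mirror_cell Q\<^sub>0 h\<^sub>0 Q) = visits w c (Q\<^sub>0, h\<^sub>0) Q" for Q
    by (rule visits_mirror[OF tame_mirror[OF assms] fin])
  ultimately show ?thesis
    using assms colouring_toured[OF assms] advance_range unfolding tame_def
    by (auto simp: toured_def)
qed


section \<open>Tours of the ant\<close>

abbreviation "config t \<equiv> config_at w Q\<^sub>0 h\<^sub>0 t"
abbreviation "port t \<equiv> (cell_at w Q\<^sub>0 h\<^sub>0 t, heading_at w Q\<^sub>0 h\<^sub>0 t)"

lemma run_0: "config 0 = (\<lambda>_. 1)" "port 0 = (Q\<^sub>0, h\<^sub>0)"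
  by (simp_all add: config_at_def cell_at_def heading_at_def ant_run_def)

lemma run_Suc:
  "port (Suc t) = follow w (config t) (port t)"
  "config (Suc t) = (config t)(fst (port t) := advance w (config t (fst (port t))))"
  by (cases "ant_run w Q\<^sub>0 h\<^sub>0 t";
      simp add: config_at_def cell_at_def heading_at_def ant_run_def follow_def advance_def Let_def)+

lemma admissible_port: "admissible Q\<^sub>0 h\<^sub>0 (port t)"
proof (induction t)
  case 0
  show ?case unfolding run_0 by (rule admissible_home)
next
  case (Suc t)
  then show ?case unfolding run_Suc by (rule admissible_follow)
qed

lemma at_home_iff: "at_home w Q\<^sub>0 h\<^sub>0 t \<longleftrightarrow> port t = (Q\<^sub>0, h\<^sub>0)"
  using entry_inject[OF admissible_port[of t] admissible_home]
  by (auto simp: at_home_def position_at_def home_position_def entry_def)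

text \<open>The real walk, which changes the cells on its way, agrees with the walk in the fixed
  initial configuration until the latter closes up.\<close>

lemma run_follows_orbit:
  assumes tame: "tame (config t)" and home: "port t = (Q\<^sub>0, h\<^sub>0)"
    and inj: "inj_on (\<lambda>j. (follow w (config t) ^^ j) (Q\<^sub>0, h\<^sub>0)) {..<T}" and "s \<le> T"
  defines "track \<equiv> \<lambda>j. (follow w (config t) ^^ j) (Q\<^sub>0, h\<^sub>0)"
  shows "port (t + s) = track s"
    and "config (t + s) = (\<lambda>Q. (advance w ^^ card {j. j < s \<and> fst (track j) = Q}) (config t Q))"
proof -
  let ?c = "config t"
  have "port (t + s) = track s \<and>
    config (t + s) = (\<lambda>Q. (advance w ^^ card {j. j < s \<and> fst (track j) = Q}) (config t Q))"
    using \<open>s \<le> T\<close>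
  proof (induction s)
    case 0
    then show ?case by (simp add: home track_def)
  next
    case (Suc s)
    then have port: "port (t + s) = track s"
      and config: "config (t + s) = (\<lambda>Q. (advance w ^^ card {j. j < s \<and> fst (track j) = Q}) (?c Q))"
      by auto
    let ?Q = "fst (track s)"
    have step: "{j. j < Suc s \<and> fst (track j) = Q} =
        (if Q = ?Q then insert s {j. j < s \<and> fst (track j) = Q} else {j. j < s \<and> fst (track j) = Q})"
      for Q
      by (auto simp: less_Suc_eq)
    have "card {j. j < Suc s \<and> fst (track j) = ?Q} \<le> visits w ?c (Q\<^sub>0, h\<^sub>0) ?Q"
      unfolding visits_def
    proof (rule card_inj_on_le)
      show "inj_on (\<lambda>j. snd (track j)) {j. j < Suc s \<and> fst (track j) = ?Q}"
      proof (rule inj_onI)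
        fix i j assume "i \<in> {j. j < Suc s \<and> fst (track j) = ?Q}"
          "j \<in> {j. j < Suc s \<and> fst (track j) = ?Q}" "snd (track i) = snd (track j)"
        then have "track i = track j" "i < T" "j < T"
          using \<open>Suc s \<le> T\<close> by (auto simp: prod_eq_iff)
        then show "i = j"
          using inj by (auto simp: track_def dest: inj_onD)
      qed
      have "(?Q, snd (track j)) \<in> orbit w ?c (Q\<^sub>0, h\<^sub>0)" if "fst (track j) = ?Q" for j
        unfolding that[symmetric] by (simp add: track_def orbit_def)
      then show "(\<lambda>j. snd (track j)) ` {j. j < Suc s \<and> fst (track j) = ?Q}
          \<subseteq> {h. (?Q, h) \<in> orbit w ?c (Q\<^sub>0, h\<^sub>0)}"
        by auto
    qed simp
    then have "card {j. j < s \<and> fst (track j) = ?Q} < visits w ?c (Q\<^sub>0, h\<^sub>0) ?Q"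
      by (simp add: step)
    then have "orientation w (config (t + s)) ?Q = orientation w ?c ?Q"
      using orientation_unvisited[OF tame] by (simp add: config orientation_def)
    then have "port (t + Suc s) = track (Suc s)"
      using run_Suc(1)[of "t + s"] unfolding port by (simp add: follow_def track_def)
    moreover have "config (t + Suc s) =
        (\<lambda>Q. (advance w ^^ card {j. j < Suc s \<and> fst (track j) = Q}) (?c Q))"
      using run_Suc(2)[of "t + s"] unfolding port config by (auto simp: step fun_eq_iff)
    ultimately show ?case ..
  qed
  then show "port (t + s) = track s"
    and "config (t + s) = (\<lambda>Q. (advance w ^^ card {j. j < s \<and> fst (track j) = Q}) (config t Q))"
    by auto
qed

lemma tour:
  assumes tame: "tame (config t)" and home: "port t = (Q\<^sub>0, h\<^sub>0)"
  defines "orb \<equiv> orbit w (config t) (Q\<^sub>0, h\<^sub>0)"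
  obtains T where "0 < T" "port (t + T) = (Q\<^sub>0, h\<^sub>0)"
    "config (t + T) = toured w (config t) (Q\<^sub>0, h\<^sub>0)"
    "inj_on (\<lambda>j. port (t + j)) {..<T}" "(\<lambda>j. port (t + j)) ` {..<T} = orb"
    "\<And>s. s < T \<Longrightarrow> port (t + Suc s) = follow w (config t) (port (t + s))"
    "\<And>s Q. s \<le> T \<Longrightarrow> config (t + s) Q =
        (advance w ^^ card {j. j < s \<and> fst (port (t + j)) = Q}) (config t Q)"
proof -
  let ?c = "config t"
  define track where "track = (\<lambda>j. (follow w ?c ^^ j) (Q\<^sub>0, h\<^sub>0))"
  obtain T where T: "0 < T" "track T = (Q\<^sub>0, h\<^sub>0)" "inj_on track {..<T}" "orb = track ` {..<T}"
    using orbit_period[OF tame_finite_orbit[OF tame, of "(Q\<^sub>0, h\<^sub>0)"]]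
    unfolding track_def orb_def by blast
  have port: "port (t + s) = track s" if "s \<le> T" for s
    using run_follows_orbit(1)[OF tame home, of T s] T(3) that unfolding track_def by simp
  have config: "config (t + s) Q = (advance w ^^ card {j. j < s \<and> fst (track j) = Q}) (?c Q)"
    if "s \<le> T" for s Q
    using run_follows_orbit(2)[OF tame home, of T s] T(3) that unfolding track_def by simp
  have "card {j. j < T \<and> fst (track j) = Q} = visits w ?c (Q\<^sub>0, h\<^sub>0) Q" for Q
  proof -
    have "bij_betw (\<lambda>j. snd (track j)) {j. j < T \<and> fst (track j) = Q} {h. (Q, h) \<in> orb}"
    proof (rule bij_betwI')
      fix i j assume "i \<in> {j. j < T \<and> fst (track j) = Q}" "j \<in> {j. j < T \<and> fst (track j) = Q}"
      then show "snd (track i) = snd (track j) \<longleftrightarrow> i = j"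
        using inj_on_eq_iff[OF T(3), of i j] by (metis (mono_tags) lessThan_iff mem_Collect_eq prod_eqI)
    next
      fix j assume "j \<in> {j. j < T \<and> fst (track j) = Q}"
      then show "snd (track j) \<in> {h. (Q, h) \<in> orb}"
        unfolding T(4) by (auto intro: rev_image_eqI)
    next
      fix h assume "h \<in> {h. (Q, h) \<in> orb}"
      then show "\<exists>j \<in> {j. j < T \<and> fst (track j) = Q}. h = snd (track j)"
        unfolding T(4) by (force simp: prod_eq_iff)
    qed
    then show ?thesis
      by (simp add: visits_def orb_def bij_betw_same_card)
  qed
  then have "config (t + T) = toured w ?c (Q\<^sub>0, h\<^sub>0)"
    by (auto simp: config toured_def)
  moreover have "config (t + s) Q =
      (advance w ^^ card {j. j < s \<and> fst (port (t + j)) = Q}) (?c Q)" if "s \<le> T" for s Q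
  proof -
    have "fst (port (t + j)) = fst (track j)" if "j < s" for j
      using port[of j] that \<open>s \<le> T\<close> by (metis less_le_trans less_imp_le)
    then have "{j. j < s \<and> fst (port (t + j)) = Q} = {j. j < s \<and> fst (track j) = Q}"
      by auto
    then show ?thesis
      by (simp only: config[OF that])
  qed
  moreover have "port (t + Suc s) = follow w ?c (port (t + s))" if "s < T" for s
    using port[of s] port[of "Suc s"] that by (simp add: track_def)
  moreover have "inj_on (\<lambda>j. port (t + j)) {..<T}"
    using T(3) port inj_on_cong[of "{..<T}" "\<lambda>j. port (t + j)" track] by simp
  moreover have "(\<lambda>j. port (t + j)) ` {..<T} = orb"
    using T(4) port image_cong[of "{..<T}" "{..<T}" "\<lambda>j. port (t + j)" track] by simp
  ultimately show ?thesis
    using that[of T] T(1,2) port[of T] by simp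
qed

lemma tour_no_earlier_return:
  assumes "port t = (Q\<^sub>0, h\<^sub>0)" "inj_on (\<lambda>j. port (t + j)) {..<T}" "t < s" "s < t + T"
  shows "port s \<noteq> (Q\<^sub>0, h\<^sub>0)"
proof
  assume "port s = (Q\<^sub>0, h\<^sub>0)"
  then have "s - t = 0"
    using assms by (intro inj_onD[OF assms(2)]) auto
  then show False
    using \<open>t < s\<close> by simp
qed

lemma tame_at_home: "port t = (Q\<^sub>0, h\<^sub>0) \<Longrightarrow> tame (config t)"
proof (induction t rule: less_induct)
  case (less t)
  show ?case
  proof (cases "t = 0")
    case True
    then show ?thesis
      using tame_initial by (simp add: run_0)
  next
    case False
    define r where "r = (GREATEST r. r < t \<and> port r = (Q\<^sub>0, h\<^sub>0))"
    have ex: "0 < t \<and> port 0 = (Q\<^sub>0, h\<^sub>0)"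
      using False run_0 by blast
    have r: "r < t \<and> port r = (Q\<^sub>0, h\<^sub>0)"
      unfolding r_def by (rule GreatestI_nat[where P = "\<lambda>r. r < t \<and> port r = (Q\<^sub>0, h\<^sub>0)", OF ex, of t]) simp
    have last: "s \<le> r" if "s < t \<and> port s = (Q\<^sub>0, h\<^sub>0)" for s
      unfolding r_def by (rule Greatest_le_nat[where P = "\<lambda>r. r < t \<and> port r = (Q\<^sub>0, h\<^sub>0)", OF that, of t]) simp
    have "tame (config r)"
      using less.IH r by blast
    obtain T where T: "0 < T" "port (r + T) = (Q\<^sub>0, h\<^sub>0)"
      "config (r + T) = toured w (config r) (Q\<^sub>0, h\<^sub>0)" "inj_on (\<lambda>j. port (r + j)) {..<T}"
      by (rule tour[OF \<open>tame (config r)\<close> conjunct2[OF r]]) blast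
    have "r + T = t"
      using last[of "r + T"] T tour_no_earlier_return[of r T t] r less.prems
      by (metis add.right_neutral add_less_cancel_left leD linorder_neqE_nat)
    then show ?thesis
      using T(3) tame_toured[OF \<open>tame (config r)\<close>] by simp
  qed
qed

end

section \<open>Temperature in words with even runs\<close>

lemma even_runs_paired:
  assumes "\<And>a m. (a, m) \<in> set runs \<Longrightarrow> even m"
  defines "u \<equiv> concat (map (\<lambda>(a, m). replicate m a) runs)"
  shows "even (length u)" and "even i \<Longrightarrow> i < length u \<Longrightarrow> u ! Suc i = u ! i"
proof -
  have "even (length u) \<and> (\<forall>i. even i \<and> i < length u \<longrightarrow> u ! Suc i = u ! i)"
    using assms(1) unfolding u_def
  proof (induction runs)
    case (Cons r runs)
    obtain a m where r: "r = (a, m)" by (cases r)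
    define v where "v = concat (map (\<lambda>(a, m). replicate m a) runs)"
    have m: "even m" and IH: "even (length v)" "\<And>i. even i \<Longrightarrow> i < length v \<Longrightarrow> v ! Suc i = v ! i"
      using Cons r by (auto simp: v_def)
    have "(replicate m a @ v) ! Suc i = (replicate m a @ v) ! i"
      if "even i" "i < m + length v" for i
    proof (cases "i < m")
      case True
      then have "Suc i < m"
        using m \<open>even i\<close> by (metis Suc_lessI even_Suc)
      then show ?thesis
        by (simp add: nth_append)
    next
      case False
      then show ?thesis
        using IH(2)[of "i - m"] m that by (simp add: nth_append Suc_diff_le)
    qed
    then show ?case
      using m IH(1) by (simp add: r flip: v_def)
  qed simp
  then show "even (length u)" and "even i \<Longrightarrow> i < length u \<Longrightarrow> u ! Suc i = u ! i"
    by auto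
qed

text \<open>Runs begin at even places of the rotated word \<open>rotate k w\<close>, that is, at states with the parity
  of \<open>Suc k\<close>; so the letter after such a state is the same.\<close>

lemma even_run_length_cold:
  assumes "w \<noteq> []" "hd w = L" "even_run_length w"
  obtains b where "even_run_ant w (\<lambda>k. even k = b)"
proof -
  obtain k runs where runs: "rotate k w = concat (map (\<lambda>(a, m). replicate m a) runs)"
    "\<And>a m. (a, m) \<in> set runs \<Longrightarrow> even m"
    using assms(3) by (fastforce simp: even_run_length_def)
  let ?n = "length w"
  have n: "even ?n" "0 < ?n"
    using even_runs_paired(1)[of runs] runs(2) assms(1) by (simp_all flip: runs(1))
  have pair: "rotate k w ! Suc i = rotate k w ! i" if "even i" "i < ?n" for i
    using even_runs_paired(2)[of runs i] runs(2) that by (simp flip: runs(1))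
  have keep: "w ! (j mod ?n) = w ! (j - 1)" if "j \<in> {1..?n}" "even j = even (Suc k)" for j
  proof -
    (* (?n - 1) * k stands for - k modulo ?n, since subtraction of naturals truncates. *)
    define i where "i = (j - 1 + (?n - 1) * k) mod ?n"
    have "even i \<longleftrightarrow> even (j - 1 + (?n - 1) * k)"
      unfolding i_def using n by (simp add: dvd_mod_iff)
    then have "even i" "i < ?n"
      using that n by (auto simp: i_def)
    then have "Suc i < ?n"
      using n by (metis Suc_lessI even_Suc)
    have "(k + i) mod ?n = (j - 1 + ((?n - 1) * k + k)) mod ?n"
      by (simp add: i_def mod_simps ac_simps)
    also have "(?n - 1) * k + k = ?n * k"
      using n by (cases ?n) auto
    finally have "(k + i) mod ?n = (j - 1) mod ?n"
      by simp
    moreover have "j - 1 < ?n"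
      using that by auto
    ultimately have i: "(k + i) mod ?n = j - 1"
      by simp
    then have "(k + Suc i) mod ?n = j mod ?n"
      using that by (metis Suc_diff_1 add_Suc_right atLeastAtMost_iff less_eq_Suc_le mod_Suc_eq One_nat_def)
    then show ?thesis
      using pair[OF \<open>even i\<close> \<open>i < ?n\<close>] \<open>i < ?n\<close> \<open>Suc i < ?n\<close> i
      by (simp add: nth_rotate add.commute)
  qed
  have "even_run_ant w (\<lambda>j. even j = even (Suc k))"
  proof
    show "w ! 0 = L"
      using assms(1,2) by (simp add: hd_conv_nth)
    fix j assume j: "j \<in> {1..?n}"
    show "(even (advance w j) = even (Suc k)) \<longleftrightarrow> \<not> (even j = even (Suc k))"
      using n by (auto simp: advance_def dvd_mod_iff)
    show "w ! (advance w j - 1) = w ! (j - 1)" if "even j = even (Suc k)"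
      using keep[OF j that] by (simp add: advance_def)
  qed (rule assms(1))
  then show ?thesis
    using that by blast
qed


section \<open>Contours as unions of routes\<close>

lemma sphere_half_iff:
  "(u, v) \<in> sphere (a, b) (1/2) \<longleftrightarrow> (u - a)\<^sup>2 + (v - b)\<^sup>2 = 1/4" for u v a b :: real
proof -
  have "(u, v) \<in> sphere (a, b) (1/2) \<longleftrightarrow> sqrt ((u - a)\<^sup>2 + (v - b)\<^sup>2) = sqrt (1/4)"
    by (simp add: dist_Pair_Pair dist_real_def real_sqrt_divide power2_commute)
  then show ?thesis by simp
qed

lemma quarter_circle:
  fixes x y a b :: real
  assumes "a \<in> {0, 1}" "b \<in> {0, 1}"
  shows "({x..x + 1} \<times> {y..y + 1}) \<inter> sphere (x + a, y + b) (1/2) =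
    (\<lambda>r. (x + a + (1 - 2 * a) * r, y + b + (1 - 2 * b) * sqrt (1/4 - r\<^sup>2))) ` {0..1/2}"
    (is "?A = ?f ` _")
proof
  show "?A \<subseteq> ?f ` {0..1/2}"
  proof
    fix z assume "z \<in> ?A"
    then obtain u v where z: "z = (u, v)" "x \<le> u" "u \<le> x + 1" "y \<le> v" "v \<le> y + 1"
      "(u - (x + a))\<^sup>2 + (v - (y + b))\<^sup>2 = 1/4"
      using sphere_half_iff by (cases z) auto
    define r s where "r = (1 - 2 * a) * (u - x - a)" and "s = (1 - 2 * b) * (v - y - b)"
    have rs: "r \<ge> 0" "s \<ge> 0" "u = x + a + (1 - 2 * a) * r" "v = y + b + (1 - 2 * b) * s"
      "r\<^sup>2 + s\<^sup>2 = 1/4"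
      using assms z by (auto simp: r_def s_def power2_eq_square algebra_simps)
    have s: "s = sqrt (1/4 - r\<^sup>2)"
      using rs by (intro real_sqrt_unique[symmetric]) auto
    have "r \<le> 1/2"
    proof (rule power2_le_imp_le)
      have "r\<^sup>2 \<le> 1/4"
        using rs(5) zero_le_power2[of s] by linarith
      then show "r\<^sup>2 \<le> (1/2)\<^sup>2"
        by (simp add: power_divide)
    qed simp
    then show "z \<in> ?f ` {0..1/2}"
      unfolding z(1) using rs s by (intro image_eqI[of _ _ r]) auto
  qed
  show "?f ` {0..1/2} \<subseteq> ?A"
  proof (rule image_subsetI)
    fix r :: real assume r: "r \<in> {0..1/2}"
    then have "r\<^sup>2 \<le> (1/2)\<^sup>2"
      by (intro power_mono) auto
    then have q: "0 \<le> 1/4 - r\<^sup>2"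
      by (simp add: power_divide)
    have "sqrt (1/4 - r\<^sup>2) \<le> sqrt 1"
      by (intro real_sqrt_le_mono) (use zero_le_power2[of r] in linarith)
    then have "0 \<le> sqrt (1/4 - r\<^sup>2)" "sqrt (1/4 - r\<^sup>2) \<le> 1"
      using q by auto
    then show "?f r \<in> ?A"
      using assms r q unfolding Int_iff sphere_half_iff by (auto simp: power_mult_distrib)
  qed
qed

lemma quarter_circle_boundary:
  fixes x y a b :: real
  assumes ab: "a \<in> {0, 1}" "b \<in> {0, 1}"
    and z: "(u, v) \<in> ({x..x + 1} \<times> {y..y + 1}) \<inter> sphere (x + a, y + b) (1/2)"
    and boundary: "u \<in> {x, x + 1} \<or> v \<in> {y, y + 1}"
  shows "(u, v) \<in> {(x + a, y + 1/2), (x + 1/2, y + b)}"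
proof -
  obtain r where r: "r \<in> {0..1/2}" "u = x + a + (1 - 2 * a) * r"
    "v = y + b + (1 - 2 * b) * sqrt (1/4 - r\<^sup>2)"
    using z unfolding quarter_circle[OF ab] by auto
  have sqrt_half: "sqrt (1/4) = (1/2 :: real)"
    by (simp add: real_sqrt_divide)
  have "sqrt (1/4 - r\<^sup>2) \<le> sqrt (1/4)"
    by (intro real_sqrt_le_mono) simp
  then have s: "sqrt (1/4 - r\<^sup>2) \<le> 1/2"
    by (simp add: sqrt_half)
  from boundary have "r = 0 \<or> sqrt (1/4 - r\<^sup>2) = 0"
    using ab r s by auto
  then show ?thesis
  proof
    assume "r = 0"
    then show ?thesis
      using ab r by (auto simp: sqrt_half)
  next
    assume 0: "sqrt (1/4 - r\<^sup>2) = 0"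
    then have "r\<^sup>2 = (1/2)\<^sup>2"
      by (simp add: power_divide)
    then have "r = 1/2"
      using r(1) by (simp add: power2_eq_iff)
    then show ?thesis
      using ab r 0 by auto
  qed
qed

text \<open>The bits \<open>a\<close> and \<open>b\<close> tell which corner of the square is the centre; the other route through the
  cell has the opposite corner.\<close>

lemma route_eq_quarter_circle:
  obtains x y a b :: real where "a \<in> {0, 1}" "b \<in> {0, 1}"
    "square (fst p) = {x..x + 1} \<times> {y..y + 1}" "fst p = (\<lfloor>x\<rfloor>, \<lfloor>y\<rfloor>)"
    "route w c p = ({x..x + 1} \<times> {y..y + 1}) \<inter> sphere (x + a, y + b) (1/2)"
    "{entry p, entry (follow w c p)} = {(x + a, y + 1/2), (x + 1/2, y + b)}"
    "route w c (fst p, opposite (snd p)) =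
      ({x..x + 1} \<times> {y..y + 1}) \<inter> sphere (x + (1 - a), y + (1 - b)) (1/2)"
proof -
  obtain x y h where p: "p = ((x, y), h)" by (metis prod.exhaust)
  let ?S = "{opposite h, turn (orientation w c (x, y)) h}"
  show ?thesis
    by (rule that[of "if East \<in> ?S then 1 else 0" "if North \<in> ?S then 1 else 0"
          "of_int x" "of_int y"];
        cases h; cases "orientation w c (x, y)")
      (auto simp: p route_def truchet_arc_def corner_def entry_def follow_def)
qed

lemma route_subset_square: "route w c p \<subseteq> square (fst p)"
  by (simp add: route_def truchet_arc_def)

lemma compact_route: "compact (route w c p)"
  by (rule route_eq_quarter_circle[of p w c]) (simp add: compact_Int_closed compact_Times)

lemma connected_route: "connected (route w c p)"
proof (rule route_eq_quarter_circle[of p w c])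
  fix x y a b :: real
  assume ab: "a \<in> {0, 1}" "b \<in> {0, 1}"
    and route: "route w c p = ({x..x + 1} \<times> {y..y + 1}) \<inter> sphere (x + a, y + b) (1/2)"
  show ?thesis
    unfolding route quarter_circle[OF ab]
    by (intro connected_continuous_image continuous_intros) auto
qed

lemma entries_in_route: "{entry p, entry (follow w c p)} \<subseteq> route w c p"
proof (rule route_eq_quarter_circle[of p w c])
  fix x y a b :: real
  assume ab: "a \<in> {0, 1}" "b \<in> {0, 1}"
    and route: "route w c p = ({x..x + 1} \<times> {y..y + 1}) \<inter> sphere (x + a, y + b) (1/2)"
    and entries: "{entry p, entry (follow w c p)} = {(x + a, y + 1/2), (x + 1/2, y + b)}"
  show ?thesis
    unfolding route entries insert_subset Int_iff sphere_half_iff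
    using ab by (auto simp: power2_eq_square)
qed

lemma route_boundary:
  assumes "z \<in> route w c p" "z \<in> square Q" "Q \<noteq> fst p"
  shows "z \<in> {entry p, entry (follow w c p)}"
proof (rule route_eq_quarter_circle[of p w c])
  fix x y a b :: real
  assume ab: "a \<in> {0, 1}" "b \<in> {0, 1}" and sq: "square (fst p) = {x..x + 1} \<times> {y..y + 1}"
    and cell: "fst p = (\<lfloor>x\<rfloor>, \<lfloor>y\<rfloor>)"
    and route: "route w c p = ({x..x + 1} \<times> {y..y + 1}) \<inter> sphere (x + a, y + b) (1/2)"
    and entries: "{entry p, entry (follow w c p)} = {(x + a, y + 1/2), (x + 1/2, y + b)}"
  obtain u v where z: "z = (u, v)" by (cases z)
  obtain m n where Q: "Q = (m, n)" by (cases Q)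
  have "{x..x + 1} \<times> {y..y + 1} = {of_int \<lfloor>x\<rfloor>..of_int \<lfloor>x\<rfloor> + 1} \<times> {of_int \<lfloor>y\<rfloor>..of_int \<lfloor>y\<rfloor> + 1}"
    using sq cell by simp
  then have xy: "x = of_int \<lfloor>x\<rfloor>" "y = of_int \<lfloor>y\<rfloor>"
    by (auto simp: times_eq_iff)
  have common: "s \<in> {of_int k, of_int k + 1}"
    if "of_int k \<le> s" "s \<le> of_int k + 1" "of_int l \<le> s" "s \<le> of_int l + 1" "k \<noteq> l"
    for k l :: int and s :: real
    using that by (cases "k < l") (auto; linarith)+
  have "u \<in> {x, x + 1} \<or> v \<in> {y, y + 1}"
  proof (cases "m = \<lfloor>x\<rfloor>")
    case True
    then have "n \<noteq> \<lfloor>y\<rfloor>"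
      using assms(3) cell by (simp add: Q)
    then show ?thesis
      using common[of "\<lfloor>y\<rfloor>" v n] assms(1,2) unfolding route z Q xy(2)[symmetric] by auto
  next
    case False
    then show ?thesis
      using common[of "\<lfloor>x\<rfloor>" u m] assms(1,2) unfolding route z Q xy(1)[symmetric] by auto
  qed
  then show ?thesis
    using quarter_circle_boundary[OF ab, of u v x y] assms(1) unfolding entries route z by blast
qed

text \<open>The centres are opposite corners of a unit square, at a distance greater than twice the
  radius.\<close>

lemma opposite_routes_disjoint: "route w c p \<inter> route w c (fst p, opposite (snd p)) = {}"
proof (rule route_eq_quarter_circle[of p w c])
  fix x y a b :: real
  assume ab: "a \<in> {0, 1}" "b \<in> {0, 1}"
    and route: "route w c p = ({x..x + 1} \<times> {y..y + 1}) \<inter> sphere (x + a, y + b) (1/2)"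
    and other: "route w c (fst p, opposite (snd p)) =
      ({x..x + 1} \<times> {y..y + 1}) \<inter> sphere (x + (1 - a), y + (1 - b)) (1/2)"
  have ge: "(s - a)\<^sup>2 + (s - (1 - a))\<^sup>2 \<ge> 1/2" if "a \<in> {0, 1}" for s a :: real
  proof -
    have "(s - a)\<^sup>2 + (s - (1 - a))\<^sup>2 - 1/2 = 2 * (s - 1/2)\<^sup>2"
      using that by (auto simp: power2_eq_square algebra_simps)
    then show ?thesis
      using zero_le_power2[of "s - 1/2"] by linarith
  qed
  have "\<not> ((u - (x + a))\<^sup>2 + (v - (y + b))\<^sup>2 = 1/4 \<and>
      (u - (x + (1 - a)))\<^sup>2 + (v - (y + (1 - b)))\<^sup>2 = 1/4)" for u v
    using ge[OF ab(1), of "u - x"] ge[OF ab(2), of "v - y"] unfolding diff_diff_eq by linarith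
  then show ?thesis
    unfolding route other using sphere_half_iff by (auto simp del: mem_sphere)
qed

lemma admissible_port_cases:
  assumes "admissible Q\<^sub>0 h\<^sub>0 p" "admissible Q\<^sub>0 h\<^sub>0 q" "fst p = fst q"
  shows "q = p \<or> q = (fst p, opposite (snd p))"
  using assms same_axis[of "snd p" "snd q"] by (cases p; cases q) (auto simp: admissible_def)

text \<open>Arcs of different cells can only share midpoints of edges, and each midpoint is the entry of a
  single admissible port.\<close>

lemma routes_meet:
  assumes p: "admissible Q\<^sub>0 h\<^sub>0 p" and q: "admissible Q\<^sub>0 h\<^sub>0 q"
    and meet: "route w c p \<inter> route w c q \<noteq> {}"
  shows "p = q \<or> q = follow w c p \<or> p = follow w c q"
proof (cases "fst p = fst q")
  case True
  then show ?thesis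
    using admissible_port_cases[OF p q] meet opposite_routes_disjoint by metis
next
  case False
  obtain z where z: "z \<in> route w c p" "z \<in> route w c q"
    using meet by blast
  have "z \<in> {entry p, entry (follow w c p)}"
    using route_boundary[OF z(1), of "fst q"] z(2) False route_subset_square by (metis subsetD)
  moreover have "z \<in> {entry q, entry (follow w c q)}"
    using route_boundary[OF z(2), of "fst p"] z(1) False route_subset_square by (metis subsetD)
  ultimately obtain p' q' where "p' \<in> {p, follow w c p}" "q' \<in> {q, follow w c q}" "entry p' = entry q'"
    by blast
  moreover from this have "p' = q'"
    using p q admissible_follow[OF p, of w c] admissible_follow[OF q, of w c]
    by (intro entry_inject[of Q\<^sub>0 h\<^sub>0]) auto
  ultimately show ?thesis
    using inj_follow[of w c] by (auto dest: injD)
qed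

text \<open>A route shared by different cells would lie in its two ends, hence be a single point by
  connectedness; but the ends differ.\<close>

lemma route_inject:
  assumes "admissible Q\<^sub>0 h\<^sub>0 p" "admissible Q\<^sub>0 h\<^sub>0 q" "route w c p = route w c q"
  shows "p = q"
proof (rule ccontr)
  assume "p \<noteq> q"
  have nonempty: "route w c p \<noteq> {}"
    using entries_in_route by blast
  then have "fst p \<noteq> fst q"
    using admissible_port_cases[OF assms(1,2)] \<open>p \<noteq> q\<close> assms(3) opposite_routes_disjoint[of w c p]
    by auto
  have sub: "route w c p \<subseteq> {entry p, entry (follow w c p)}"
  proof
    fix z assume z: "z \<in> route w c p"
    then have "z \<in> square (fst q)"
      using route_subset_square[of w c q] unfolding assms(3) by blast
    then show "z \<in> {entry p, entry (follow w c p)}"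
      using route_boundary[OF z] \<open>fst p \<noteq> fst q\<close> by metis
  qed
  have "finite (route w c p)"
    by (rule finite_subset[OF sub]) simp
  then have "\<exists>z. route w c p = {z}"
    using connected_finite_iff_sing[OF connected_route, of w c p] nonempty by blast
  then have "entry (follow w c p) = entry p"
    using entries_in_route[of p w c] by auto
  then have "follow w c p = p"
    using entry_inject assms(1) admissible_follow by blast
  then show False
    using snd_follow[of w c p] horizontal_turn by metis
qed

lemma tile_arcs_eq_routes:
  "tile_arcs w Q\<^sub>0 h\<^sub>0 c Q = route w c ` {p. fst p = Q \<and> admissible Q\<^sub>0 h\<^sub>0 p}"
proof -
  have ports: "{p. fst p = Q \<and> admissible Q\<^sub>0 h\<^sub>0 p} =
      (if H_cell Q\<^sub>0 h\<^sub>0 Q then {(Q, East), (Q, West)} else {(Q, North), (Q, South)})"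
    (is "?A = ?B")
  proof (rule set_eqI)
    show "p \<in> ?A \<longleftrightarrow> p \<in> ?B" for p
      by (cases p; cases "snd p") (auto simp: admissible_def horizontal_def)
  qed
  have comm: "truchet_arc Q a b = truchet_arc Q b a" for a b
    by (simp add: truchet_arc_def corner_def insert_commute)
  show ?thesis
    unfolding ports tile_arcs_def
    by (cases "orientation w c Q")
      (auto simp: route_def comm[of North] comm[of West South] comm[of East South])
qed

lemma truchet_union_eq_routes:
  "truchet_union w Q\<^sub>0 h\<^sub>0 c = \<Union> (route w c ` {p. admissible Q\<^sub>0 h\<^sub>0 p})"
  unfolding truchet_union_def tile_arcs_eq_routes by auto

lemma finite_squares_near: "finite {Q. square Q \<inter> ball z 1 \<noteq> {}}"
proof -
  obtain u v :: real where z: "z = (u, v)" by (cases z)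
  have "{Q. square Q \<inter> ball z 1 \<noteq> {}} \<subseteq> {\<lfloor>u\<rfloor> - 2..\<lfloor>u\<rfloor> + 2} \<times> {\<lfloor>v\<rfloor> - 2..\<lfloor>v\<rfloor> + 2}"
  proof
    fix Q assume "Q \<in> {Q. square Q \<inter> ball z 1 \<noteq> {}}"
    then obtain u' v' where *: "(u', v') \<in> square Q" "dist z (u', v') < 1"
      by auto
    have "\<bar>u - u'\<bar> < 1" "\<bar>v - v'\<bar> < 1"
      using * dist_fst_le[of z "(u', v')"] dist_snd_le[of z "(u', v')"]
      by (auto simp: z dist_real_def)
    then show "Q \<in> {\<lfloor>u\<rfloor> - 2..\<lfloor>u\<rfloor> + 2} \<times> {\<lfloor>v\<rfloor> - 2..\<lfloor>v\<rfloor> + 2}"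
      using *(1) by (cases Q) (auto simp: abs_if split: if_splits; linarith)
  qed
  then show ?thesis
    by (rule finite_subset) simp
qed

text \<open>Arbitrary unions of routes are closed by local finiteness. Applied to the orbit and to its
  complement, this separates the principal contour from all other arcs.\<close>

lemma closed_Union_routes: "closed (\<Union> (route w c ` A))"
proof -
  have "locally_finite_in euclidean (route w c ` A)"
    unfolding locally_finite_in_def
  proof (intro conjI ballI)
    fix z :: point
    have "{S \<in> route w c ` A. S \<inter> ball z 1 \<noteq> {}}
        \<subseteq> route w c ` ({Q. square Q \<inter> ball z 1 \<noteq> {}} \<times> UNIV)"
      using route_subset_square[of w c] by (force intro!: imageI simp: mem_Times_iff)
    then have "finite {S \<in> route w c ` A. S \<inter> ball z 1 \<noteq> {}}"
      by (rule finite_subset) (intro finite_imageI finite_cartesian_product finite_squares_near finite_headings)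
    then show "\<exists>V. openin euclidean V \<and> z \<in> V \<and> finite {U \<in> route w c ` A. U \<inter> V \<noteq> {}}"
      by (intro exI[of _ "ball z 1"]) auto
  qed simp
  then have "closedin euclidean (\<Union> (route w c ` A))"
    by (intro closedin_locally_finite_Union) (auto intro: compact_imp_closed compact_route)
  then show ?thesis by simp
qed

lemma connected_Union_orbit: "connected (\<Union> (route w c ` orbit w c p))"
proof -
  let ?r = "\<lambda>j. route w c ((follow w c ^^ j) p)"
  have seg: "connected (\<Union>j\<le>n. ?r j)" for n
  proof (induction n)
    case 0
    then show ?case by (simp add: connected_route)
  next
    case (Suc n)
    have "entry ((follow w c ^^ Suc n) p) \<in> (\<Union>j\<le>n. ?r j) \<inter> ?r (Suc n)"
      using entries_in_route[of "(follow w c ^^ n) p" w c]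
        entries_in_route[of "(follow w c ^^ Suc n) p" w c] by auto
    then have "connected ((\<Union>j\<le>n. ?r j) \<union> ?r (Suc n))"
      using Suc connected_route by (intro connected_Un) blast+
    then show ?case
      by (simp add: atMost_Suc Un_commute)
  qed
  have "connected (\<Union> (range (\<lambda>n. \<Union>j\<le>n. ?r j)))"
  proof (rule connected_Union)
    have "entry p \<in> (\<Union>j\<le>n. ?r j)" for n
      using entries_in_route[of p w c] by (intro UN_I[of 0]) auto
    then show "\<Inter> (range (\<lambda>n. \<Union>j\<le>n. ?r j)) \<noteq> {}"
      by blast
  qed (use seg in auto)
  moreover have "\<Union> (range (\<lambda>n. \<Union>j\<le>n. ?r j)) = \<Union> (route w c ` orbit w c p)"
    by (auto simp: orbit_def)
  ultimately show ?thesis by simp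
qed

lemma route_meets_orbit:
  assumes fin: "finite (orbit w c p)" and p: "admissible Q\<^sub>0 h\<^sub>0 p" and q: "admissible Q\<^sub>0 h\<^sub>0 q"
    and meet: "route w c q \<inter> \<Union> (route w c ` orbit w c p) \<noteq> {}"
  shows "q \<in> orbit w c p"
proof -
  obtain r where r: "r \<in> orbit w c p" "route w c q \<inter> route w c r \<noteq> {}"
    using meet by blast
  then have "q = r \<or> r = follow w c q \<or> q = follow w c r"
    using routes_meet[OF q admissible_orbit[OF p r(1)]] by blast
  then show ?thesis
    using r(1) follow_mem_orbit_iff[OF fin] by blast
qed

lemma principal_contour_eq_orbit:
  assumes fin: "finite (orbit w c (Q\<^sub>0, h\<^sub>0))"
  shows "principal_contour w Q\<^sub>0 h\<^sub>0 c = \<Union> (route w c ` orbit w c (Q\<^sub>0, h\<^sub>0))" (is "_ = ?C")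
proof
  let ?D = "\<Union> (route w c ` ({p. admissible Q\<^sub>0 h\<^sub>0 p} - orbit w c (Q\<^sub>0, h\<^sub>0)))"
  have home: "home_position Q\<^sub>0 h\<^sub>0 \<in> ?C"
    using entries_in_route[of "(Q\<^sub>0, h\<^sub>0)" w c] orbit_self[of "(Q\<^sub>0, h\<^sub>0)" w c]
    by (auto simp: entry_def home_position_def)
  have sub: "?C \<subseteq> truchet_union w Q\<^sub>0 h\<^sub>0 c"
    unfolding truchet_union_eq_routes
    by (intro Union_mono image_mono subsetI CollectI) (rule admissible_orbit[OF admissible_home])
  show "?C \<subseteq> principal_contour w Q\<^sub>0 h\<^sub>0 c"
    unfolding principal_contour_def
    by (rule connected_component_maximal[OF home connected_Union_orbit sub])
  let ?S = "principal_contour w Q\<^sub>0 h\<^sub>0 c"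
  have "?S \<subseteq> truchet_union w Q\<^sub>0 h\<^sub>0 c"
    unfolding principal_contour_def by (rule connected_component_subset)
  also have "truchet_union w Q\<^sub>0 h\<^sub>0 c \<subseteq> ?C \<union> ?D"
    unfolding truchet_union_eq_routes by blast
  finally have "?S \<subseteq> ?C \<union> ?D" .
  moreover have "?C \<inter> ?D = {}"
    using route_meets_orbit[OF fin admissible_home] by blast
  moreover have "connected ?S"
    unfolding principal_contour_def by (rule connected_connected_component)
  ultimately have "?C \<inter> ?S = {} \<or> ?D \<inter> ?S = {}"
    by (intro connected_closedD) (auto simp: closed_Union_routes simp del: UN_simps)
  moreover have "home_position Q\<^sub>0 h\<^sub>0 \<in> ?S"
    using home sub unfolding principal_contour_def by (auto simp: connected_component_refl_eq)
  ultimately show "?S \<subseteq> ?C"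
    using home \<open>?S \<subseteq> ?C \<union> ?D\<close> by blast
qed


section \<open>Tours around the principal contour\<close>

context even_run_ant
begin

lemma next_return_tour:
  assumes home: "port t = (Q\<^sub>0, h\<^sub>0)" and "next_return w Q\<^sub>0 h\<^sub>0 t t'"
  defines "c \<equiv> config t"
  shows "inj_on port {t..<t'}" "port ` {t..<t'} = orbit w c (Q\<^sub>0, h\<^sub>0)"
    and "\<And>s. t \<le> s \<Longrightarrow> s < t' \<Longrightarrow> port (Suc s) = follow w c (port s)"
    and "\<And>s Q. t \<le> s \<Longrightarrow> s < t' \<Longrightarrow> \<forall>r. t \<le> r \<and> r < s \<longrightarrow> cell_at w Q\<^sub>0 h\<^sub>0 r \<noteq> Q \<Longrightarrow> config s Q = c Q"
proof -
  obtain T where T: "0 < T" "port (t + T) = (Q\<^sub>0, h\<^sub>0)"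
    "inj_on (\<lambda>j. port (t + j)) {..<T}" "(\<lambda>j. port (t + j)) ` {..<T} = orbit w c (Q\<^sub>0, h\<^sub>0)"
    "\<And>s. s < T \<Longrightarrow> port (t + Suc s) = follow w c (port (t + s))"
    "\<And>s Q. s \<le> T \<Longrightarrow> config (t + s) Q =
        (advance w ^^ card {j. j < s \<and> fst (port (t + j)) = Q}) (c Q)"
    unfolding c_def by (rule tour[OF tame_at_home[OF home] home]) blast
  have nr: "t < t'" "port t' = (Q\<^sub>0, h\<^sub>0)" "\<And>s. t < s \<Longrightarrow> s < t' \<Longrightarrow> port s \<noteq> (Q\<^sub>0, h\<^sub>0)"
    using assms(2) unfolding next_return_def at_home_iff by blast+
  have "\<not> t + T < t'"
    using nr(3)[of "t + T"] T(1,2) by (metis less_add_same_cancel1)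
  moreover have "\<not> t' < t + T"
    using tour_no_earlier_return[OF home T(3) nr(1)] nr(2) by blast
  ultimately have t': "t' = t + T"
    by simp
  have times: "{t..<t'} = (+) t ` {..<T}"
    by (simp add: t' lessThan_atLeast0 add.commute)
  show "inj_on port {t..<t'}"
    using T(3) unfolding times by (simp add: inj_on_image_iff comp_def inj_on_def)
  show "port ` {t..<t'} = orbit w c (Q\<^sub>0, h\<^sub>0)"
    using T(4) unfolding times image_image .
  show "port (Suc s) = follow w c (port s)" if "t \<le> s" "s < t'" for s
    using T(5)[of "s - t"] that by (simp add: t')
  show "config s Q = c Q"
    if "t \<le> s" "s < t'" "\<forall>r. t \<le> r \<and> r < s \<longrightarrow> cell_at w Q\<^sub>0 h\<^sub>0 r \<noteq> Q" for s Q
  proof -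
    have unvisited: "{j. j < s - t \<and> fst (port (t + j)) = Q} = {}"
      using that by auto
    show ?thesis
      using T(6)[of "s - t" Q] that unfolding unvisited by (simp add: t')
  qed
qed

lemma traversed_arc_eq_route:
  assumes "port (Suc s) = follow w c (port s)"
  shows "traversed_arc w Q\<^sub>0 h\<^sub>0 s = route w c (port s)"
  using arg_cong[OF assms, of snd]
  by (simp add: traversed_arc_def route_def snd_follow)

lemma infinitely_often_home: "infinite {t. at_home w Q\<^sub>0 h\<^sub>0 t}"
proof
  assume fin: "finite {t. at_home w Q\<^sub>0 h\<^sub>0 t}"
  have "at_home w Q\<^sub>0 h\<^sub>0 0"
    unfolding at_home_iff by (rule run_0)
  define m where "m = Max {t. at_home w Q\<^sub>0 h\<^sub>0 t}"
  have "m \<in> {t. at_home w Q\<^sub>0 h\<^sub>0 t}"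
    unfolding m_def using fin \<open>at_home w Q\<^sub>0 h\<^sub>0 0\<close> by (intro Max_in) auto
  then have home: "port m = (Q\<^sub>0, h\<^sub>0)"
    by (simp only: at_home_iff mem_Collect_eq)
  obtain T where "0 < T" "port (m + T) = (Q\<^sub>0, h\<^sub>0)"
    by (rule tour[OF tame_at_home[OF home] home]) blast
  then have "m + T \<in> {t. at_home w Q\<^sub>0 h\<^sub>0 t}"
    by (simp only: at_home_iff mem_Collect_eq)
  then show False
    using Max_ge[OF fin, of "m + T"] \<open>0 < T\<close> by (simp flip: m_def)
qed

lemma tour_of_principal_contour:
  assumes home: "port t = (Q\<^sub>0, h\<^sub>0)" and return: "next_return w Q\<^sub>0 h\<^sub>0 t t'"
  shows "travels_once_around w Q\<^sub>0 h\<^sub>0 t t' (principal_contour w Q\<^sub>0 h\<^sub>0 (config t))"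
proof -
  note nr = next_return_tour[OF home return]
  have arc: "traversed_arc w Q\<^sub>0 h\<^sub>0 s = route w (config t) (port s)" if "s \<in> {t..<t'}" for s
    using that nr(3) by (intro traversed_arc_eq_route) auto
  have "inj_on (route w (config t)) (port ` {t..<t'})"
    unfolding nr(2) using admissible_orbit[OF admissible_home]
    by (intro inj_onI route_inject[of Q\<^sub>0 h\<^sub>0]) blast+
  then have "inj_on (\<lambda>s. route w (config t) (port s)) {t..<t'}"
    using comp_inj_on[OF nr(1)] by (simp add: comp_def)
  then have "inj_on (traversed_arc w Q\<^sub>0 h\<^sub>0) {t..<t'}"
    using inj_on_cong[of "{t..<t'}" "traversed_arc w Q\<^sub>0 h\<^sub>0" "\<lambda>s. route w (config t) (port s)"] arc
    by blast
  moreover have "(\<Union>s\<in>{t..<t'}. traversed_arc w Q\<^sub>0 h\<^sub>0 s) = \<Union> (route w (config t) ` port ` {t..<t'})"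
    using arc by (simp add: image_image)
  ultimately show ?thesis
    unfolding travels_once_around_def nr(2)
    using principal_contour_eq_orbit[OF tame_finite_orbit[OF tame_at_home[OF home]]] by metis
qed

lemma first_visit_keeps_orientation:
  assumes home: "port t = (Q\<^sub>0, h\<^sub>0)" and return: "next_return w Q\<^sub>0 h\<^sub>0 t t'"
    and twice: "visits_twice w Q\<^sub>0 h\<^sub>0 (config t) (principal_contour w Q\<^sub>0 h\<^sub>0 (config t)) Q"
    and s: "t \<le> s" "s < t'" "cell_at w Q\<^sub>0 h\<^sub>0 s = Q"
    and first: "\<forall>r. t \<le> r \<and> r < s \<longrightarrow> cell_at w Q\<^sub>0 h\<^sub>0 r \<noteq> Q"
  shows "orientation w (config (Suc s)) Q = orientation w (config s) Q"
proof -
  let ?c = "config t"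
  note tame = tame_at_home[OF home]
  note fin = tame_finite_orbit[OF tame, of "(Q\<^sub>0, h\<^sub>0)"]
  have in_orbit: "q \<in> orbit w ?c (Q\<^sub>0, h\<^sub>0)" if q: "admissible Q\<^sub>0 h\<^sub>0 q" "fst q = Q" for q
  proof -
    have "route w ?c q \<subseteq> \<Union> (route w ?c ` orbit w ?c (Q\<^sub>0, h\<^sub>0))"
      using twice q unfolding visits_twice_def tile_arcs_eq_routes principal_contour_eq_orbit[OF fin]
      by blast
    moreover have "route w ?c q \<noteq> {}"
      using entries_in_route by blast
    ultimately show ?thesis
      by (intro route_meets_orbit[OF fin admissible_home q(1)]) blast
  qed
  obtain h where h: "admissible Q\<^sub>0 h\<^sub>0 (Q, h)"
    using exists_admissible by blast
  then have "admissible Q\<^sub>0 h\<^sub>0 (Q, opposite h)"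
    by (simp add: admissible_def)
  with h have "visits w ?c (Q\<^sub>0, h\<^sub>0) Q = 2"
    using in_orbit by (simp add: visits_admissible)
  then have "cold (?c Q)"
    by (rule cold_if_visited_twice[OF tame])
  moreover have "config s Q = ?c Q"
    by (rule next_return_tour(4)[OF home return s(1,2) first])
  moreover have "config (Suc s) Q = advance w (config s Q)"
    using s(3) by (simp add: run_Suc(2))
  ultimately show ?thesis
    using cold_keeps[OF tame_state[OF tame]] by (simp add: orientation_def)
qed

end

theorem mainTheorem1:
  fixes w :: "letter list" and Q\<^sub>0 :: cell and h\<^sub>0 :: direction
  assumes "w \<noteq> []" and "hd w = L" and "even_run_length w"
  shows "infinite {t. at_home w Q\<^sub>0 h\<^sub>0 t} \<and>
    (\<forall>t t'. at_home w Q\<^sub>0 h\<^sub>0 t \<and> next_return w Q\<^sub>0 h\<^sub>0 t t' \<longrightarrow>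
      (let c = config_at w Q\<^sub>0 h\<^sub>0 t; C = principal_contour w Q\<^sub>0 h\<^sub>0 c
       in travels_once_around w Q\<^sub>0 h\<^sub>0 t t' C \<and>
          (\<forall>Q s. visits_twice w Q\<^sub>0 h\<^sub>0 c C Q \<and>
             t \<le> s \<and> s < t' \<and> cell_at w Q\<^sub>0 h\<^sub>0 s = Q \<and>
             (\<forall>r. t \<le> r \<and> r < s \<longrightarrow> cell_at w Q\<^sub>0 h\<^sub>0 r \<noteq> Q) \<longrightarrow>
             orientation w (config_at w Q\<^sub>0 h\<^sub>0 (Suc s)) Q =
             orientation w (config_at w Q\<^sub>0 h\<^sub>0 s) Q))) \<and>
    (\<forall>t. at_home w Q\<^sub>0 h\<^sub>0 t \<longrightarrow>
      (\<forall>Q. config_at w Q\<^sub>0 h\<^sub>0 t Q = config_at w Q\<^sub>0 h\<^sub>0 t (mirror_cell Q\<^sub>0 h\<^sub>0 Q)))"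
proof -
  obtain b where "even_run_ant w (\<lambda>k. even k = b)"
    using even_run_length_cold[OF assms] .
  then interpret even_run_ant w Q\<^sub>0 h\<^sub>0 "\<lambda>k. even k = b" .
  show ?thesis
    unfolding Let_def
    using infinitely_often_home tour_of_principal_contour first_visit_keeps_orientation
      tame_mirror[OF tame_at_home] at_home_iff
    by metis
qed

end
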